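(* Let $\kappa$ be a regular uncountable cardinal and $\lambda \geq \kappa$ a cardinal. Suppose that $2^\kappa \leq \lambda$, and let $D \in NS_{\kappa,\lambda}^\ast$. Then setting $J = I_{\kappa,\lambda} \vert D$, the following hold: (i) $J^+ \xrightarrow{J} (J^+)^2_\omega$ does not hold. (ii) $J^+ \xrightarrow{J} (J^+)^3_2$ does not hold. (iii) $J$ is not $(\lambda, 2)$-distributive.
   Context: $P_\kappa(\lambda) = \{a \subseteq \lambda : |a| < \kappa\}$. An ideal on a set $X$ is a nonempty collection $J$ of subsets of $X$, closed under subsets and under unions of two members, with $X \notin J$. $J^+ = \{A \subseteq X : A \notin J\}$, $J^\ast = \{A \subseteq X : X \setminus A \in J\}$, and for $A \in J^+$, $J \vert A = \{B \subseteq X : B \cap A \in J\}$. $I_{\kappa,\lambda}$ is the ideal of all $A \subseteq P_\kappa(\lambda)$ such that for some $a \in P_\kappa(\lambda)$, no $b \in A$ satisfies $a \subseteq b$. $NS_{\kappa,\lambda}$ is the nonstationary ideal on $P_\kappa(\lambda)$. $P(A)$ denotes the power set of $A$. Given $2 \leq n < \omega$, collections $X, Y$ of subsets of $P_\kappa(\lambda)$, an ideal $J$ on $P_\kappa(\lambda)$ and a cardinal $\rho$, $X \xrightarrow{Y} (J^+)^n_\rho$ means: for any $F : (P_\kappa(\lambda))^n \to \rho$ and any $A \in X$, there are $i < \rho$, $B \in J^+ \cap P(A)$, and $Z_a \in Y$ for $a \in B$ such that $F(a_1, \dots, a_n) = i$ whenever $a_1, \dots, a_n \in B$ and $a_{m+1}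 \notin Z_{a_1} \cup \cdots \cup Z_{a_m}$ for $1 \leq m < n$. For an ideal $J$ on $X$, $MAD(J)$ is the collection of all $Q \subseteq J^+$ such that $A \cap B \in J$ for any two distinct $A, B \in Q$, and for any $C \in J^+$ there is $A \in Q$ with $A \cap C \in J^+$. For nonzero cardinals $\rho, \nu$, $J$ is $(\rho,\nu)$-distributive if, given $A \in J^+$ and $Q_\alpha \in MAD(J)$ with $|Q_\alpha| \leq \nu$ for $\alpha < \rho$, there are $B \in J^+ \cap P(A)$ and $h \in \prod_{\alpha < \rho} Q_\alpha$ such that $B \setminus h(\alpha) \in J$ for every $\alpha < \rho$. *)

theory Defs
  imports Main
begin

unbundle cardinal_syntax

text \<open>
  Cardinals are cardinal well-orders \<open>\<kappa>\<close>, \<open>\<Lambda>\<close> (predicate \<^const>\<open>Card_order\<close>); the set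
  of ordinals below \<open>\<Lambda>\<close> is rendered by \<open>Field \<Lambda>\<close>. (A capital letter because the lower-case
  one is the abstraction symbol.)
\<close>

definition Pkl :: "'k rel \<Rightarrow> 'l rel \<Rightarrow> 'l set set" where
  "Pkl \<kappa> \<Lambda> = {a. a \<subseteq> Field \<Lambda> \<and> |a| <o \<kappa>}"

text \<open>Since \<open>J\<close> does not determine its underlying set \<open>X\<close>, the latter is an explicit argument.\<close>

definition ideal_pos :: "'x set \<Rightarrow> 'x set set \<Rightarrow> 'x set set" where
  "ideal_pos X J = {A. A \<subseteq> X \<and> A \<notin> J}"

definition ideal_dual :: "'x set \<Rightarrow> 'x set set \<Rightarrow> 'x set set" where
  "ideal_dual X J = {A. A \<subseteq> X \<and> X - A \<in> J}"

definition ideal_restrict :: "'x set \<Rightarrow> 'x set set \<Rightarrow> 'x set \<Rightarrow> 'x set set" where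
  "ideal_restrict X J A = {B. B \<subseteq> X \<and> B \<inter> A \<in> J}"

definition I_ideal :: "'k rel \<Rightarrow> 'l rel \<Rightarrow> 'l set set set" where
  "I_ideal \<kappa> \<Lambda> = {A. A \<subseteq> Pkl \<kappa> \<Lambda> \<and> (\<exists>a\<in>Pkl \<kappa> \<Lambda>. \<not> (\<exists>b\<in>A. a \<subseteq> b))}"

text \<open>
  Closed unbounded subsets of \<open>P\<^sub>\<kappa>(\<Lambda>)\<close>. Closure is required under unions of nonempty
  \<open>\<subseteq>\<close>-chains of size less than \<open>\<kappa>\<close>; these have the same unions as the increasing sequences
  of length less than \<open>\<kappa>\<close>.
\<close>

definition club :: "'k rel \<Rightarrow> 'l rel \<Rightarrow> 'l set set \<Rightarrow> bool" where
  "club \<kappa> \<Lambda> C \<longleftrightarrow>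
     C \<subseteq> Pkl \<kappa> \<Lambda> \<and>
     (\<forall>a\<in>Pkl \<kappa> \<Lambda>. \<exists>b\<in>C. a \<subseteq> b) \<and>
     (\<forall>S. S \<subseteq> C \<and> S \<noteq> {} \<and> chain\<^sub>\<subseteq> S \<and> |S| <o \<kappa> \<longrightarrow> \<Union>S \<in> C)"

definition NS_ideal :: "'k rel \<Rightarrow> 'l rel \<Rightarrow> 'l set set set" where
  "NS_ideal \<kappa> \<Lambda> = {A. A \<subseteq> Pkl \<kappa> \<Lambda> \<and> (\<exists>C. club \<kappa> \<Lambda> C \<and> A \<inter> C = {})}"

text \<open>
  \<open>partition_rel S X Y J n \<rho>\<close> is \<open>X \<rightarrow>\<^sup>Y (J\<^sup>+)\<^sup>n\<^sub>\<rho>\<close> for an ideal \<open>J\<close> on \<open>S\<close>. An \<open>n\<close>-tuple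
  \<open>(a\<^sub>1, \<dots>, a\<^sub>n)\<close> is a list \<open>as\<close> of length \<open>n\<close>, so \<open>a\<^sub>m\<^sub>+\<^sub>1\<close> is \<open>as ! m\<close> and \<open>a\<^sub>1, \<dots>, a\<^sub>m\<close> are the
  \<open>as ! j\<close> with \<open>j < m\<close>.
\<close>

definition partition_rel ::
  "'x set \<Rightarrow> 'x set set \<Rightarrow> 'x set set \<Rightarrow> 'x set set \<Rightarrow> nat \<Rightarrow> 'r rel \<Rightarrow> bool" where
  "partition_rel S X Y J n \<rho> \<longleftrightarrow>
     (\<forall>F :: 'x list \<Rightarrow> 'r.
       (\<forall>as. length as = n \<and> set as \<subseteq> S \<longrightarrow> F as \<in> Field \<rho>) \<longrightarrow>
       (\<forall>A\<in>X. \<exists>i\<in>Field \<rho>. \<exists>B \<in> ideal_pos S J \<inter> Pow A. \<exists>Z :: 'x \<Rightarrow> 'x set.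
          (\<forall>a\<in>B. Z a \<in> Y) \<and>
          (\<forall>as. length as = n \<and> set as \<subseteq> B \<and>
                (\<forall>m. 1 \<le> m \<and> m < n \<longrightarrow> as ! m \<notin> (\<Union>j<m. Z (as ! j))) \<longrightarrow>
                F as = i)))"

definition MAD :: "'x set \<Rightarrow> 'x set set \<Rightarrow> 'x set set set" where
  "MAD X J = {Q. Q \<subseteq> ideal_pos X J \<and>
                 (\<forall>A\<in>Q. \<forall>B\<in>Q. A \<noteq> B \<longrightarrow> A \<inter> B \<in> J) \<and>
                 (\<forall>C\<in>ideal_pos X J. \<exists>A\<in>Q. A \<inter> C \<in> ideal_pos X J)}"

definition distributive :: "'x set \<Rightarrow> 'x set set \<Rightarrow> 'r rel \<Rightarrow> 'v rel \<Rightarrow> bool" where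
  "distributive X J \<rho> \<nu> \<longleftrightarrow>
     (\<forall>A\<in>ideal_pos X J. \<forall>Q :: 'r \<Rightarrow> 'x set set.
       (\<forall>\<alpha>\<in>Field \<rho>. Q \<alpha> \<in> MAD X J \<and> |Q \<alpha>| \<le>o \<nu>) \<longrightarrow>
       (\<exists>B \<in> ideal_pos X J \<inter> Pow A. \<exists>h :: 'r \<Rightarrow> 'x set.
          (\<forall>\<alpha>\<in>Field \<rho>. h \<alpha> \<in> Q \<alpha>) \<and> (\<forall>\<alpha>\<in>Field \<rho>. B - h \<alpha> \<in> J)))"

end

theory Submission
  imports Defs
begin

text \<open>
  Write \<open>\<lambda>\<close> for the cardinal \<open>\<Lambda>\<close>. Each of the three properties in question implies one principle,
  \<open>level_bounding\<close>: if natural numbers \<open>G x b\<close> are assigned to \<open>x < \<lambda>\<close> and \<open>b \<in> P\<^sub>\<kappa>(\<lambda>)\<close>, and an element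
  \<open>\<phi> a\<close> of \<open>\<lambda>\<close> to each \<open>a \<in> P\<^sub>\<kappa>(\<lambda>)\<close>, then every \<open>J\<close>-positive set has a \<open>J\<close>-positive subset \<open>B\<close> with a
  number \<open>n\<close> such that, for each \<open>a \<in> B\<close>, \<open>G (\<phi> a) b \<le> n\<close> holds for \<open>J\<close>-almost all \<open>b \<in> B\<close>. The proof
  refutes this principle (\<open>not_level_bounding\<close>).

  The counterexample lives on a positive set \<open>A\<close> of unions \<open>c = \<Union>\<^sub>n a\<^sub>n\<close> of increasing sequences of length
  \<open>\<omega>\<close> from a club inside \<open>D\<close>, and \<open>G \<gamma> c\<close> is the first stage at which \<open>\<gamma> < \<kappa>\<^sup>+\<close> enters \<open>c\<close>. Suppose that
  \<open>B\<close> and \<open>n\<close> are as above, and let \<open>\<phi> a < \<kappa>\<^sup>+\<close> bound \<open>a \<inter> \<kappa>\<^sup>+\<close>. The set \<open>\<Gamma> = \<phi>[B]\<close> has size \<open>\<kappa>\<^sup>+\<close>, and each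
  \<open>\<gamma> \<in> \<Gamma>\<close> has a set \<open>e \<gamma> \<in> P\<^sub>\<kappa>(\<lambda>)\<close> such that \<open>e \<gamma> \<subseteq> b \<in> B\<close> implies \<open>G \<gamma> b \<le> n\<close>. If for some \<open>X \<subseteq> \<Gamma>\<close> of
  size \<open>\<kappa>\<close> the function \<open>e\<close> on \<open>X\<close> can be coded by fewer than \<open>\<kappa>\<close> ordinals below \<open>\<lambda>\<close>, then some \<open>b \<in> B\<close>
  contains these codes. The sequences are built so that, from the stage on at which a code has appeared,
  every stage adds a new element of \<open>X\<close>, and a set \<open>e \<gamma>\<close> with \<open>\<gamma> \<in> X \<inter> b\<close> is eventually included. So some
  \<open>\<gamma> \<in> X\<close> enters \<open>b\<close> after stage \<open>n\<close> although \<open>e \<gamma> \<subseteq> b\<close>: a contradiction.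

  Such codes exist for all \<open>e\<close> (\<open>ex_coding\<close>, \<open>many_sets_in_few_segments\<close>) because \<open>level_bounding\<close> gives
  \<open>\<nu>\<^sup>\<kappa> \<le> \<lambda>\<close> for all \<open>\<nu> < \<lambda>\<close>. In fact it implies \<open>\<nu>\<^sup>\<kappa> \<le> \<nu>\<^sup>+\<close> whenever \<open>2\<^sup>\<kappa> \<le> \<nu> < \<lambda>\<close>, by induction on \<open>\<nu>\<close>
  (\<open>card_of_subsets_upto_less\<close>). The case of cofinality above \<open>\<kappa>\<close> is trivial. Uncountable
  cofinality up to \<open>\<kappa>\<close> is Silver's theorem on the singular cardinals problem. Countable cofinality
  is the only case that needs \<open>level_bounding\<close>; the argument is in the spirit of Solovay's theorem that the
  singular cardinals hypothesis holds above a strongly compact cardinal.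
\<close>

section \<open>Sets of small subsets, and cardinal arithmetic\<close>

definition subsets_upto :: "'k rel \<Rightarrow> 'a set \<Rightarrow> 'a set set" where
  "subsets_upto \<kappa> S = {Y. Y \<subseteq> S \<and> |Y| \<le>o \<kappa>}"

lemma card_of_subsets_upto_mono:
  assumes "|S| \<le>o |S'|"
  shows "|subsets_upto \<kappa> S| \<le>o |subsets_upto \<kappa> S'|"
proof -
  obtain f where f: "inj_on f S" "f ` S \<subseteq> S'"
    using assms unfolding card_of_ordLeq[symmetric] by blast
  have "inj_on (image f) (subsets_upto \<kappa> S)"
    unfolding inj_on_def subsets_upto_def using inj_on_image_eq_iff[OF f(1)] by auto
  moreover have "image f ` subsets_upto \<kappa> S \<subseteq> subsets_upto \<kappa> S'"
  proof
    fix Y' assume "Y' \<in> image f ` subsets_upto \<kappa> S"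
    then obtain Y where Y: "Y' = f ` Y" "Y \<subseteq> S" "|Y| \<le>o \<kappa>" unfolding subsets_upto_def by auto
    then show "Y' \<in> subsets_upto \<kappa> S'"
      using f(2) ordLeq_transitive[OF card_of_image[of f Y]] unfolding subsets_upto_def by auto
  qed
  ultimately show ?thesis by (intro card_of_ordLeqI) auto
qed

text \<open>
  A nonempty set of size at most \<open>\<kappa>\<close> is the range of a function on \<open>\<kappa>\<close>, and \<open>(2\<^sup>\<kappa>)\<^sup>\<kappa> = 2\<^sup>\<kappa>\<close>.
\<close>

lemma card_of_subsets_upto_cexp:
  assumes k: "Cinfinite \<kappa>" and S: "|S| \<le>o ctwo ^c \<kappa>"
  shows "|subsets_upto \<kappa> S| \<le>o ctwo ^c \<kappa>"
proof -
  have inf: "Cinfinite (ctwo ^c \<kappa>)"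
    using k by (simp add: cinfinite_cexp ctwo_ordLeq_Cinfinite ordLeq_refl Card_order_ctwo Card_order_cexp)
  have img: "subsets_upto \<kappa> S - {{}} \<subseteq> (\<lambda>f. f ` Field \<kappa>) ` Func (Field \<kappa>) S"
  proof
    fix Y assume Y: "Y \<in> subsets_upto \<kappa> S - {{}}"
    have "|Y| \<le>o |Field \<kappa>|"
      using Y k card_of_Field_ordIso ordIso_symmetric ordLeq_ordIso_trans
      unfolding subsets_upto_def by blast
    then obtain g where g: "g ` Field \<kappa> = Y"
      using Y card_of_ordLeq2[of Y "Field \<kappa>"] by auto
    define f where "f = (\<lambda>x. if x \<in> Field \<kappa> then g x else undefined)"
    have "f \<in> Func (Field \<kappa>) S" "f ` Field \<kappa> = Y"
      using g Y unfolding f_def Func_def subsets_upto_def by auto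
    then show "Y \<in> (\<lambda>f. f ` Field \<kappa>) ` Func (Field \<kappa>) S" by blast
  qed
  have "|subsets_upto \<kappa> S - {{}}| \<le>o |Func (Field \<kappa>) S|"
    using card_of_mono1[OF img] card_of_image ordLeq_transitive by blast
  also have "|Func (Field \<kappa>) S| =o |S| ^c \<kappa>"
    unfolding cexp_def Field_card_of by (rule card_of_refl)
  also have "|S| ^c \<kappa> \<le>o (ctwo ^c \<kappa>) ^c \<kappa>"
    using S k cexp_mono1 by blast
  also have "(ctwo ^c \<kappa>) ^c \<kappa> =o ctwo ^c (\<kappa> *c \<kappa>)"
    by (rule cexp_cprod[OF Card_order_ctwo])
  also have "ctwo ^c (\<kappa> *c \<kappa>) =o ctwo ^c \<kappa>"
    using k cexp_cong2[OF cprod_infinite Card_order_ctwo Card_order_cprod] by blast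
  finally have 1: "|subsets_upto \<kappa> S - {{}}| \<le>o ctwo ^c \<kappa>" .
  have "|{{}}| \<le>o ctwo ^c \<kappa>"
    using Card_order_singl_ordLeq[OF conjunct2[OF inf] Cnotzero_imp_not_empty[OF Cinfinite_Cnotzero[OF inf]]] .
  then have "|(subsets_upto \<kappa> S - {{}}) \<union> {{}}| \<le>o ctwo ^c \<kappa>"
    using 1 inf Un_Cinfinite_bound by blast
  moreover have "subsets_upto \<kappa> S \<subseteq> (subsets_upto \<kappa> S - {{}}) \<union> {{}}" by blast
  ultimately show ?thesis using card_of_mono1 ordLeq_transitive by blast
qed

text \<open>
  Otherwise some \<open>y\<close> lies outside the sections of all members of a subset of \<open>A\<close> of size \<open>\<nu>\<^sup>+\<close>. By
  totality, the section of \<open>y\<close> then contains this whole subset.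
\<close>

lemma card_of_total_relation:
  assumes nu: "Cinfinite \<nu>"
    and total: "\<And>x y. x \<in> A \<Longrightarrow> y \<in> A \<Longrightarrow> R x y \<or> R y x"
    and sections: "\<And>y. y \<in> A \<Longrightarrow> |{x \<in> A. R x y}| \<le>o \<nu>"
  shows "|A| \<le>o cardSuc \<nu>"
proof (rule ccontr)
  have suc: "Cinfinite (cardSuc \<nu>)" using nu Cinfinite_cardSuc by blast
  assume "\<not> |A| \<le>o cardSuc \<nu>"
  then have less: "cardSuc \<nu> <o |A|"
    using suc not_ordLeq_iff_ordLess card_of_Well_order card_order_on_well_order_on by blast
  then obtain A0 where A0: "A0 \<subseteq> A" "|A0| =o cardSuc \<nu>"
    using internalize_card_of_ordLeq2[of "Field (cardSuc \<nu>)" A] suc card_of_Field_ordIso[of "cardSuc \<nu>"]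
  proof -
    have "|Field (cardSuc \<nu>)| \<le>o |A|"
      using ordIso_ordLeq_trans[OF card_of_Field_ordIso ordLess_imp_ordLeq[OF less]] suc by blast
    then obtain A0 where "A0 \<subseteq> A" "|Field (cardSuc \<nu>)| =o |A0|"
      using internalize_card_of_ordLeq2[of "Field (cardSuc \<nu>)" A] by blast
    then show ?thesis
      using that ordIso_transitive[OF ordIso_symmetric card_of_Field_ordIso] suc by blast
  qed
  define W where "W = (\<Union>y\<in>A0. {x \<in> A. R x y})"
  have "|W| \<le>o cardSuc \<nu>"
    unfolding W_def
  proof (rule UNION_Cinfinite_bound[OF _ _ suc])
    show "|A0| \<le>o cardSuc \<nu>" using A0(2) ordIso_imp_ordLeq by blast
    show "\<forall>y\<in>A0. |{x \<in> A. R x y}| \<le>o cardSuc \<nu>"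
      using A0(1) sections nu cardSuc_ordLeq ordLeq_transitive by blast
  qed
  then have "|W| <o |A|" using less ordLeq_ordLess_trans by blast
  then have "\<not> A \<subseteq> W"
    using card_of_mono1[of A W] not_ordLess_ordLeq by blast
  then obtain y where y: "y \<in> A" "y \<notin> W" by blast
  have "A0 \<subseteq> {x \<in> A. R x y}"
    using total y A0(1) unfolding W_def by blast
  then have "|A0| \<le>o \<nu>" by (rule ordLeq_transitive[OF card_of_mono1 sections[OF y(1)]])
  then have "cardSuc \<nu> \<le>o \<nu>" by (rule ordIso_ordLeq_trans[OF ordIso_symmetric[OF A0(2)]])
  then show False using nu cardSuc_greater not_ordLess_ordLeq by blast
qed

text \<open>
  By regularity \<open>Z\<close> has a weak upper bound, and an infinite cardinal has no largest element.
\<close>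

lemma strict_bound_of_small:
  assumes r: "Cinfinite r" "regularCard r" and Z: "Z \<subseteq> Field r" "|Z| <o r"
  obtains u where "u \<in> Field r" "\<And>z. z \<in> Z \<Longrightarrow> z \<in> underS r u"
proof -
  have wo: "wo_rel r" using r(1) card_order_on_well_order_on unfolding wo_rel_def by blast
  have "\<not> cofinal Z r"
    using r(2) Z not_ordLess_ordIso unfolding regularCard_def by blast
  then obtain a where a: "a \<in> Field r" "\<And>b. b \<in> Z \<Longrightarrow> a = b \<or> (a, b) \<notin> r"
    unfolding cofinal_def by blast
  obtain u where u: "u \<in> Field r" "a \<noteq> u" "(a, u) \<in> r"
    using infinite_Card_order_limit[of r a] r(1) a(1) unfolding cinfinite_def
    by (metis FieldI2)
  have "z \<in> underS r u" if "z \<in> Z" for z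
  proof -
    have "(z, a) \<in> r"
      using a(2)[OF that] a(1) Z(1) that wo wo_rel.TOTALS[OF wo] by blast
    then show ?thesis
      using u wo_rel.TRANS[OF wo] wo_rel.ANTISYM[OF wo] unfolding underS_def trans_def antisym_def by blast
  qed
  then show ?thesis using that u(1) by blast
qed

lemma finite_less_Cinfinite: "Cinfinite r \<Longrightarrow> finite A \<Longrightarrow> |A| <o r"
  using Cfinite_ordLess_Cinfinite[of "|A|" r]
  by (simp add: cfinite_def Field_card_of card_of_card_order_on)

lemma card_of_under_less:
  assumes "Cinfinite r" "a \<in> Field r"
  shows "|under r a| <o r"
proof -
  have "|underS r a| <o r" using card_of_underS[of r a] assms by blast
  moreover have "|{a}| <o r"
    by (rule finite_less_Cinfinite[OF assms(1)]) simp
  ultimately have "|underS r a \<union> {a}| <o r" using Un_Cinfinite_bound_strict[OF _ _ assms(1)] by blast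
  moreover have "under r a \<subseteq> underS r a \<union> {a}" unfolding under_def underS_def by auto
  ultimately show ?thesis using ordLeq_ordLess_trans[OF card_of_mono1] by blast
qed

section \<open>Stationary sets and pressing down\<close>

text \<open>
  Least elements are excluded since they are closed under every function.
\<close>

definition closed_under :: "'i rel \<Rightarrow> ('i \<Rightarrow> 'i) \<Rightarrow> 'i \<Rightarrow> bool" where
  "closed_under \<tau> k \<zeta> \<longleftrightarrow> underS \<tau> \<zeta> \<noteq> {} \<and> (\<forall>i\<in>underS \<tau> \<zeta>. k i \<in> underS \<tau> \<zeta>)"

text \<open>
  For a regular uncountable \<open>\<tau>\<close>, these are the stationary sets: the closure points of a
  function form a club, and every club contains the closure points of the function that sends \<open>i\<close> to
  the next element of the club above \<open>i\<close>. In this form neither clubs nor limits have to be discussed.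
\<close>

definition thick :: "'i rel \<Rightarrow> 'i set \<Rightarrow> bool" where
  "thick \<tau> X \<longleftrightarrow> (\<forall>k. k ` Field \<tau> \<subseteq> Field \<tau> \<longrightarrow> (\<exists>\<zeta>\<in>X. closed_under \<tau> k \<zeta>))"

lemma underS_trans:
  assumes "Well_order r" "a \<in> underS r b" "b \<in> underS r c"
  shows "a \<in> underS r c"
proof -
  have wo: "wo_rel r" using assms(1) by (simp add: wo_rel_def)
  show ?thesis
    using assms(2,3) wo_rel.TRANS[OF wo] wo_rel.ANTISYM[OF wo] unfolding underS_def trans_def antisym_def by blast
qed

lemma underS_cases:
  assumes "Well_order r" "a \<in> Field r" "b \<in> Field r"
  shows "a \<in> underS r b \<or> a = b \<or> b \<in> underS r a"
proof -
  have wo: "wo_rel r" using assms(1) by (simp add: wo_rel_def)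
  show ?thesis
    using assms(2,3) wo_rel.TOTALS[OF wo] unfolding underS_def by blast
qed

text \<open>
  Iterate \<open>\<omega>\<close> times the step from \<open>z\<close> to a strict bound of \<open>z\<close> and of the values of \<open>k\<close> up to \<open>z\<close>; the
  supremum of the iterates is a closure point.
\<close>

lemma ex_closed_point:
  assumes tau: "Cinfinite \<tau>" "regularCard \<tau>" "natLeq <o \<tau>" and k: "k ` Field \<tau> \<subseteq> Field \<tau>"
  shows "\<exists>\<zeta>\<in>Field \<tau>. closed_under \<tau> k \<zeta>"
proof -
  have Wo: "Well_order \<tau>" using tau(1) card_order_on_well_order_on by blast
  have wo: "wo_rel \<tau>" using Wo by (simp add: wo_rel_def)
  have step: "\<exists>u\<in>Field \<tau>. z \<in> underS \<tau> u \<and> (\<forall>i\<in>under \<tau> z. k i \<in> underS \<tau> u)" if z: "z \<in> Field \<tau>" for z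
  proof -
    have "|k ` under \<tau> z| <o \<tau>"
      by (rule ordLeq_ordLess_trans[OF card_of_image card_of_under_less[OF tau(1) z]])
    moreover have "k ` under \<tau> z \<subseteq> Field \<tau>" using k under_Field[of \<tau> z] by blast
    ultimately obtain u where u: "u \<in> Field \<tau>" "\<And>x. x \<in> k ` under \<tau> z \<Longrightarrow> x \<in> underS \<tau> u"
      using strict_bound_of_small[OF tau(1,2)] by blast
    have "|{z}| <o \<tau>"
      by (rule finite_less_Cinfinite[OF tau(1)]) simp
    then obtain v where v: "v \<in> Field \<tau>" "z \<in> underS \<tau> v"
      using strict_bound_of_small[OF tau(1,2), of "{z}"] z by blast
    show ?thesis
    proof (cases "u \<in> underS \<tau> v")
      case True
      then have "\<forall>i\<in>under \<tau> z. k i \<in> underS \<tau> v"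
        by (auto intro: underS_trans[OF Wo u(2) True])
      then show ?thesis using v by blast
    next
      case False
      then have "v = u \<or> v \<in> underS \<tau> u" using underS_cases[OF Wo u(1) v(1)] by blast
      then have "z \<in> underS \<tau> u" using v(2) underS_trans[OF Wo v(2)] by blast
      then show ?thesis using u by blast
    qed
  qed
  then obtain nxt where nxt: "\<And>z. z \<in> Field \<tau> \<Longrightarrow> nxt z \<in> Field \<tau>"
    "\<And>z. z \<in> Field \<tau> \<Longrightarrow> z \<in> underS \<tau> (nxt z)"
    "\<And>z i. z \<in> Field \<tau> \<Longrightarrow> i \<in> under \<tau> z \<Longrightarrow> k i \<in> underS \<tau> (nxt z)"
    by metis
  obtain z0 where z0: "z0 \<in> Field \<tau>"
    using Cnotzero_imp_not_empty[OF Cinfinite_Cnotzero[OF tau(1)]] by blast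
  define z where "z = (\<lambda>n::nat. (nxt ^^ n) z0)"
  have zS: "z (Suc n) = nxt (z n)" for n unfolding z_def by simp
  have zF: "z n \<in> Field \<tau>" for n
    by (induction n) (use z0 nxt(1) zS in \<open>auto simp: z_def\<close>)
  have "|range z| \<le>o natLeq"
    using ordLeq_ordIso_trans[OF card_of_image[of z UNIV] card_of_nat] .
  then have "|range z| <o \<tau>" by (rule ordLeq_ordLess_trans[OF _ tau(3)])
  then obtain b where b: "b \<in> Field \<tau>" "\<And>x. x \<in> range z \<Longrightarrow> x \<in> underS \<tau> b"
    using strict_bound_of_small[OF tau(1,2), of "range z"] zF by blast
  define B where "B = {\<zeta> \<in> Field \<tau>. \<forall>n. z n \<in> underS \<tau> \<zeta>}"
  have B: "B \<subseteq> Field \<tau>" "B \<noteq> {}" using b unfolding B_def by auto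
  define \<zeta> where "\<zeta> = wo_rel.minim \<tau> B"
  have zB: "\<zeta> \<in> B" unfolding \<zeta>_def using wo_rel.minim_in[OF wo B] .
  have least: "(\<zeta>, x) \<in> \<tau>" if "x \<in> B" for x unfolding \<zeta>_def using wo_rel.minim_least[OF wo B(1) that] .
  have "k i \<in> underS \<tau> \<zeta>" if i: "i \<in> underS \<tau> \<zeta>" for i
  proof -
    have iF: "i \<in> Field \<tau>" by (rule underS_Field[OF i])
    have "i \<notin> B" using i least[of i] wo_rel.ANTISYM[OF wo] unfolding underS_def antisym_def by blast
    then obtain n where n: "z n \<notin> underS \<tau> i" using iF unfolding B_def by blast
    then have "i \<in> under \<tau> (z n)"
      using underS_cases[OF Wo zF[of n] iF] wo_rel.REFL[OF wo] iF unfolding under_def underS_def refl_on_def by blast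
    then have "k i \<in> underS \<tau> (z (Suc n))" using nxt(3)[OF zF] zS by simp
    moreover have "z (Suc n) \<in> underS \<tau> \<zeta>" using zB unfolding B_def by blast
    ultimately show ?thesis by (rule underS_trans[OF Wo])
  qed
  moreover have "underS \<tau> \<zeta> \<noteq> {}" using zB unfolding B_def by blast
  ultimately show ?thesis using zB unfolding B_def closed_under_def by blast
qed

text \<open>
  A closure point of the maximum of two functions is a closure point of both.
\<close>

lemma thick_or_complement_thick:
  assumes tau: "Cinfinite \<tau>" "regularCard \<tau>" "natLeq <o \<tau>" and X: "Field \<tau> \<subseteq> X \<union> X'"
  shows "thick \<tau> X \<or> thick \<tau> X'"
proof (rule ccontr)
  have Wo: "Well_order \<tau>" using tau(1) card_order_on_well_order_on by blast
  assume "\<not> ?thesis"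
  then have nt: "\<not> thick \<tau> X" "\<not> thick \<tau> X'" by simp_all
  obtain k where k: "k ` Field \<tau> \<subseteq> Field \<tau>" "\<forall>\<zeta>\<in>X. \<not> closed_under \<tau> k \<zeta>"
    using nt(1) unfolding thick_def by blast
  obtain k' where k': "k' ` Field \<tau> \<subseteq> Field \<tau>" "\<forall>\<zeta>\<in>X'. \<not> closed_under \<tau> k' \<zeta>"
    using nt(2) unfolding thick_def by blast
  define m where "m = (\<lambda>i. if k i \<in> underS \<tau> (k' i) then k' i else k i)"
  have "m ` Field \<tau> \<subseteq> Field \<tau>" using k(1) k'(1) unfolding m_def image_subset_iff by simp
  then obtain \<zeta> where z: "\<zeta> \<in> Field \<tau>" "closed_under \<tau> m \<zeta>"
    using ex_closed_point[OF tau] by blast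
  have "k i \<in> underS \<tau> \<zeta> \<and> k' i \<in> underS \<tau> \<zeta>" if i: "i \<in> underS \<tau> \<zeta>" for i
  proof -
    have iF: "i \<in> Field \<tau>" by (rule underS_Field[OF i])
    have m: "m i \<in> underS \<tau> \<zeta>" using z(2) i unfolding closed_under_def by blast
    show ?thesis
    proof (cases "k i \<in> underS \<tau> (k' i)")
      case True
      then show ?thesis using m underS_trans[OF Wo True] unfolding m_def by simp
    next
      case False
      then have "k' i = k i \<or> k' i \<in> underS \<tau> (k i)"
        using underS_cases[OF Wo, of "k i" "k' i"] k(1) k'(1) iF unfolding image_subset_iff by metis
      moreover have "k i \<in> underS \<tau> \<zeta>" using m False unfolding m_def by simp
      ultimately show ?thesis using underS_trans[OF Wo, of "k' i" "k i" \<zeta>] by metis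
    qed
  qed
  then have "closed_under \<tau> k \<zeta>" "closed_under \<tau> k' \<zeta>"
    using z(2) unfolding closed_under_def by auto
  then show False using X z(1) k(2) k'(2) by blast
qed

text \<open>
  Fodor's lemma, with an unbounded rather than a stationary conclusion: if for each \<open>i\<close> the \<open>\<zeta>\<close> with
  \<open>h \<zeta> \<in> U i\<close> were bounded by some \<open>k i\<close>, then a closure point of \<open>k\<close> in \<open>X\<close> would contradict the
  hypothesis on \<open>h\<close>.
\<close>

lemma pressing_down:
  assumes thick: "thick \<tau> X"
    and h: "\<And>\<zeta>. \<zeta> \<in> X \<Longrightarrow> underS \<tau> \<zeta> \<noteq> {} \<Longrightarrow> h \<zeta> \<in> (\<Union>i\<in>underS \<tau> \<zeta>. U i)"
  shows "\<exists>i\<in>Field \<tau>. \<forall>j\<in>Field \<tau>. \<exists>\<zeta>\<in>X. j \<in> underS \<tau> \<zeta> \<and> h \<zeta> \<in> U i"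
proof (rule ccontr)
  assume "\<not> ?thesis"
  then have "\<forall>i\<in>Field \<tau>. \<exists>j\<in>Field \<tau>. \<forall>\<zeta>\<in>X. h \<zeta> \<in> U i \<longrightarrow> j \<notin> underS \<tau> \<zeta>" by blast
  then obtain k where k: "\<And>i. i \<in> Field \<tau> \<Longrightarrow> k i \<in> Field \<tau>"
    "\<And>i \<zeta>. i \<in> Field \<tau> \<Longrightarrow> \<zeta> \<in> X \<Longrightarrow> h \<zeta> \<in> U i \<Longrightarrow> k i \<notin> underS \<tau> \<zeta>"
    by metis
  then have "k ` Field \<tau> \<subseteq> Field \<tau>" by blast
  then obtain \<zeta> where z: "\<zeta> \<in> X" "closed_under \<tau> k \<zeta>"
    using thick unfolding thick_def by blast
  then obtain i where "i \<in> underS \<tau> \<zeta>" "h \<zeta> \<in> U i"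
    using h unfolding closed_under_def by blast
  then show False using k(2)[of i \<zeta>] z underS_Field[of i \<tau> \<zeta>] unfolding closed_under_def by blast
qed

section \<open>Powers at uncountable cofinality: Silver's theorem\<close>

lemma Card_order_not_ordLeq:
  assumes "Card_order r" "Card_order r'" "\<not> r \<le>o r'"
  shows "r' <o r"
proof -
  have "Well_order r" "Well_order r'" using assms(1,2) card_order_on_well_order_on by blast+
  then show ?thesis using assms(3) not_ordLeq_iff_ordLess by blast
qed

lemma Cinfinite_ctwo_cexp: "Cinfinite \<kappa> \<Longrightarrow> Cinfinite (ctwo ^c \<kappa>)"
  by (simp add: cinfinite_cexp ctwo_ordLeq_Cinfinite ordLeq_refl Card_order_ctwo Card_order_cexp)

lemma less_ctwo_cexp: "Cinfinite \<kappa> \<Longrightarrow> \<kappa> <o ctwo ^c \<kappa>"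
  by (rule ordLess_ctwo_cexp) simp

lemma Cinfinite_card_of: "infinite A \<Longrightarrow> Cinfinite |A|"
  by (simp add: cinfinite_def Field_card_of card_of_card_order_on)

lemma ordLeq_if_less_cardSuc:
  assumes "|A| <o cardSuc |B|" shows "|A| \<le>o |B|"
  using assms cardSuc_ordLeq_ordLess[of "|B|" "|A|"] by (simp add: card_of_Card_order)

lemma cardSuc_le_of_less:
  assumes "|A| <o |B|" shows "cardSuc |A| \<le>o |B|"
  using assms cardSuc_ordLess_ordLeq[of "|A|" "|B|"] by (simp add: card_of_Card_order)

text \<open>
  Silver's argument. Let \<open>P \<zeta>\<close> be the union of the \<open>U i\<close> with \<open>i < \<zeta>\<close>, and well-order the set \<open>Q \<zeta>\<close> of its
  small subsets in order type at most \<open>|P \<zeta>|\<^sup>+\<close>, so that initial segments inject into \<open>P \<zeta>\<close>. Let \<open>R y y'\<close>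
  mean that \<open>y \<inter> P \<zeta>\<close> precedes or equals \<open>y' \<inter> P \<zeta>\<close> for stationarily many \<open>\<zeta>\<close>. This relation is total, so that by
  \<open>card_of_total_relation\<close> it suffices that its sections have size at most \<open>|S|\<close>. If \<open>R x y\<close> holds, then the
  injections turn \<open>x \<inter> P \<zeta>\<close> into an element of \<open>P \<zeta>\<close>, and pressing down puts these elements into one
  \<open>U i\<close> for unboundedly many \<open>\<zeta>\<close>. So \<open>x\<close> is determined by a subset of \<open>\<tau> \<times> U i\<close> of size at most \<open>\<kappa>\<close>, and
  by assumption there are at most \<open>|S|\<close> of these.
\<close>

lemma card_of_subsets_upto_uncountable_cofinality:
  fixes \<kappa> :: "'k rel" and \<tau> :: "'i rel" and U :: "'i \<Rightarrow> 'a set"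
  assumes kappa: "Cinfinite \<kappa>"
    and tau: "Cinfinite \<tau>" "regularCard \<tau>" "natLeq <o \<tau>" "\<tau> \<le>o \<kappa>"
    and cover: "(\<Union>i\<in>Field \<tau>. U i) = S"
    and large: "\<And>i. i \<in> Field \<tau> \<Longrightarrow> ctwo ^c \<kappa> \<le>o |U i|"
    and small: "\<And>\<zeta>. \<zeta> \<in> Field \<tau> \<Longrightarrow> |\<Union>i\<in>underS \<tau> \<zeta>. U i| <o |S|"
    and below: "\<And>S'. S' \<subseteq> S \<Longrightarrow> ctwo ^c \<kappa> \<le>o |S'| \<Longrightarrow> |S'| <o |S|
        \<Longrightarrow> |subsets_upto \<kappa> S'| \<le>o cardSuc |S'|"
  shows "|subsets_upto \<kappa> S| \<le>o cardSuc |S|"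
proof -
  have two: "Cinfinite (ctwo ^c \<kappa>)" by (rule Cinfinite_ctwo_cexp[OF kappa])
  have inf_if: "infinite A" if "ctwo ^c \<kappa> \<le>o |A|" for A :: "'a set"
    using cinfinite_mono[OF that] two unfolding cinfinite_def Field_card_of by blast
  have above: "\<exists>j\<in>Field \<tau>. i \<in> underS \<tau> j" if "i \<in> Field \<tau>" for i
    using strict_bound_of_small[OF tau(1,2), of "{i}"] finite_less_Cinfinite[OF tau(1), of "{i}"] that by blast
  have U_small: "|U i| <o |S|" and U_sub: "U i \<subseteq> S" if i: "i \<in> Field \<tau>" for i
  proof -
    obtain j where j: "j \<in> Field \<tau>" "i \<in> underS \<tau> j" using above[OF i] by blast
    have "U i \<subseteq> (\<Union>i\<in>underS \<tau> j. U i)" using j(2) by blast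
    then show "|U i| <o |S|" using ordLeq_ordLess_trans[OF card_of_mono1 small[OF j(1)]] by blast
    show "U i \<subseteq> S" using cover i by blast
  qed
  obtain i0 where i0: "i0 \<in> Field \<tau>"
    using Cnotzero_imp_not_empty[OF Cinfinite_Cnotzero[OF tau(1)]] by blast
  have two_S: "ctwo ^c \<kappa> \<le>o |S|"
    by (rule ordLeq_transitive[OF large[OF i0] card_of_mono1[OF U_sub[OF i0]]])
  have S_inf: "Cinfinite |S|" using inf_if[OF two_S] by (rule Cinfinite_card_of)
  have kappa_S: "\<kappa> \<le>o |S|"
    using ordLeq_transitive[OF ordLess_imp_ordLeq[OF less_ctwo_cexp[OF kappa]] two_S] .
  have tau_S: "\<tau> \<le>o |S|" by (rule ordLeq_transitive[OF tau(4) kappa_S])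
  have Field_tau: "|Field \<tau>| =o \<tau>" using card_of_Field_ordIso tau(1) by blast
  have Field_tau_S: "|Field \<tau>| \<le>o |S|" by (rule ordIso_ordLeq_trans[OF Field_tau tau_S])
  define P where "P = (\<lambda>\<zeta>. \<Union>i\<in>underS \<tau> \<zeta>. U i)"
  define Q where "Q = (\<lambda>\<zeta>. subsets_upto \<kappa> (P \<zeta>))"
  have PS: "P \<zeta> \<subseteq> S" if "\<zeta> \<in> Field \<tau>" for \<zeta>
    unfolding P_def using U_sub underS_Field by fastforce
  have inQ: "y \<inter> P \<zeta> \<in> Q \<zeta>" if "y \<in> subsets_upto \<kappa> S" for y \<zeta>
    using that ordLeq_transitive[OF card_of_mono1[of "y \<inter> P \<zeta>" y]]
    unfolding Q_def subsets_upto_def by auto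
  have "\<exists>h. inj_on h (under |Q \<zeta>| q) \<and> h ` under |Q \<zeta>| q \<subseteq> P \<zeta>"
    if z: "\<zeta> \<in> Field \<tau>" "underS \<tau> \<zeta> \<noteq> {}" and q: "q \<in> Q \<zeta>" for \<zeta> q
  proof -
    obtain i where i: "i \<in> underS \<tau> \<zeta>" using z(2) by blast
    have "U i \<subseteq> P \<zeta>" using i unfolding P_def by blast
    then have two_P: "ctwo ^c \<kappa> \<le>o |P \<zeta>|"
      using ordLeq_transitive[OF large[OF underS_Field[OF i]] card_of_mono1] by blast
    have "|P \<zeta>| <o |S|" using small[OF z(1)] unfolding P_def .
    then have Q_le: "|Q \<zeta>| \<le>o cardSuc |P \<zeta>|"
      unfolding Q_def using below[OF PS[OF z(1)] two_P] by blast
    have P_inf: "infinite (P \<zeta>)" by (rule inf_if[OF two_P])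
    have "|underS |Q \<zeta>| q| <o |Q \<zeta>|"
      using card_of_underS[OF card_of_Card_order, of q "Q \<zeta>"] q by (simp add: Field_card_of)
    then have "|underS |Q \<zeta>| q| \<le>o |P \<zeta>|"
      using ordLess_ordLeq_trans[OF _ Q_le] ordLeq_if_less_cardSuc by blast
    moreover have "|{q}| \<le>o |P \<zeta>|"
      by (rule card_of_singl_ordLeq) (use P_inf in auto)
    ultimately have "|underS |Q \<zeta>| q \<union> {q}| \<le>o |P \<zeta>|"
      using Un_Cinfinite_bound Cinfinite_card_of[OF P_inf] by blast
    moreover have "under |Q \<zeta>| q \<subseteq> underS |Q \<zeta>| q \<union> {q}" unfolding under_def underS_def by blast
    ultimately have "|under |Q \<zeta>| q| \<le>o |P \<zeta>|" using ordLeq_transitive[OF card_of_mono1] by blast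
    then show ?thesis unfolding card_of_ordLeq[symmetric] .
  qed
  then obtain h where h: "\<And>\<zeta> q. \<zeta> \<in> Field \<tau> \<Longrightarrow> underS \<tau> \<zeta> \<noteq> {} \<Longrightarrow> q \<in> Q \<zeta> \<Longrightarrow> inj_on (h \<zeta> q) (under |Q \<zeta>| q)"
    "\<And>\<zeta> q. \<zeta> \<in> Field \<tau> \<Longrightarrow> underS \<tau> \<zeta> \<noteq> {} \<Longrightarrow> q \<in> Q \<zeta> \<Longrightarrow> h \<zeta> q ` under |Q \<zeta>| q \<subseteq> P \<zeta>"
    by metis
  define R where "R = (\<lambda>y y'. thick \<tau> {\<zeta> \<in> Field \<tau>. (y \<inter> P \<zeta>, y' \<inter> P \<zeta>) \<in> |Q \<zeta>|})"
  show ?thesis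
  proof (rule card_of_total_relation[OF S_inf, where R = R])
    fix x y assume xy: "x \<in> subsets_upto \<kappa> S" "y \<in> subsets_upto \<kappa> S"
    have "(x \<inter> P \<zeta>, y \<inter> P \<zeta>) \<in> |Q \<zeta>| \<or> (y \<inter> P \<zeta>, x \<inter> P \<zeta>) \<in> |Q \<zeta>|" for \<zeta>
    proof -
      have "wo_rel |Q \<zeta>|" using card_of_Well_order unfolding wo_rel_def by blast
      then show ?thesis
        using wo_rel.TOTALS[of "|Q \<zeta>|"] inQ[OF xy(1), of \<zeta>] inQ[OF xy(2), of \<zeta>]
        unfolding Field_card_of by blast
    qed
    then show "R x y \<or> R y x"
      unfolding R_def by (intro thick_or_complement_thick[OF tau(1-3)]) auto
  next
    fix y assume y: "y \<in> subsets_upto \<kappa> S"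
    \<comment> \<open>Recovers \<open>x\<close> from the pairs of \<open>\<zeta>\<close> and the image of \<open>x \<inter> P \<zeta>\<close> under the injection for \<open>y \<inter> P \<zeta>\<close>.\<close>
    define dec where "dec = (\<lambda>g. \<Union>{q. \<exists>\<zeta> s. (\<zeta>, s) \<in> g \<and> q \<in> under |Q \<zeta>| (y \<inter> P \<zeta>) \<and> h \<zeta> (y \<inter> P \<zeta>) q = s})"
    have "{x \<in> subsets_upto \<kappa> S. R x y} \<subseteq> dec ` (\<Union>i\<in>Field \<tau>. subsets_upto \<kappa> (Field \<tau> \<times> U i))"
    proof
      fix x assume "x \<in> {x \<in> subsets_upto \<kappa> S. R x y}"
      then have x: "x \<in> subsets_upto \<kappa> S" and th: "thick \<tau> {\<zeta> \<in> Field \<tau>. (x \<inter> P \<zeta>, y \<inter> P \<zeta>) \<in> |Q \<zeta>|}"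
        unfolding R_def by blast+
      define X where "X = {\<zeta> \<in> Field \<tau>. (x \<inter> P \<zeta>, y \<inter> P \<zeta>) \<in> |Q \<zeta>|}"
      define H where "H = (\<lambda>\<zeta>. h \<zeta> (y \<inter> P \<zeta>) (x \<inter> P \<zeta>))"
      have xu: "x \<inter> P \<zeta> \<in> under |Q \<zeta>| (y \<inter> P \<zeta>)" if "\<zeta> \<in> X" for \<zeta>
        using that unfolding X_def under_def by blast
      have "H \<zeta> \<in> (\<Union>i\<in>underS \<tau> \<zeta>. U i)" if z: "\<zeta> \<in> X" "underS \<tau> \<zeta> \<noteq> {}" for \<zeta>
      proof -
        have "\<zeta> \<in> Field \<tau>" using z(1) unfolding X_def by blast
        then show ?thesis
          using h(2)[OF _ z(2) inQ[OF y]] xu[OF z(1)] unfolding H_def P_def by blast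
      qed
      then obtain i where i: "i \<in> Field \<tau>"
        "\<forall>j\<in>Field \<tau>. \<exists>\<zeta>\<in>X. j \<in> underS \<tau> \<zeta> \<and> H \<zeta> \<in> U i"
        using pressing_down[of \<tau> X H U] th unfolding X_def by blast
      define g where "g = {(\<zeta>, s). \<zeta> \<in> X \<and> underS \<tau> \<zeta> \<noteq> {} \<and> s = H \<zeta> \<and> s \<in> U i}"
      have gsub: "g \<subseteq> Field \<tau> \<times> U i" unfolding g_def X_def by blast
      have "inj_on fst g" unfolding g_def inj_on_def by auto
      moreover have "fst ` g \<subseteq> Field \<tau>" using gsub by auto
      ultimately have "|g| \<le>o |Field \<tau>|" unfolding card_of_ordLeq[symmetric] by blast
      then have "|g| \<le>o \<kappa>"
        using ordLeq_transitive[OF _ ordIso_ordLeq_trans[OF Field_tau tau(4)]] by blast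
      then have gin: "g \<in> subsets_upto \<kappa> (Field \<tau> \<times> U i)" using gsub unfolding subsets_upto_def by blast
      \<comment> \<open>Injectivity makes \<open>x \<inter> P \<zeta>\<close> the only set that \<open>dec\<close> reads off from a pair with first component \<open>\<zeta>\<close>.\<close>
      have only: "q = x \<inter> P \<zeta>" if "(\<zeta>, s) \<in> g" "q \<in> under |Q \<zeta>| (y \<inter> P \<zeta>)" "h \<zeta> (y \<inter> P \<zeta>) q = s" for \<zeta> s q
      proof -
        have z: "\<zeta> \<in> X" "underS \<tau> \<zeta> \<noteq> {}" "s = H \<zeta>" using that(1) unfolding g_def by blast+
        then have "\<zeta> \<in> Field \<tau>" unfolding X_def by blast
        then have "inj_on (h \<zeta> (y \<inter> P \<zeta>)) (under |Q \<zeta>| (y \<inter> P \<zeta>))" using h(1) z(2) inQ[OF y] by blast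
        then show ?thesis using that(2,3) xu[OF z(1)] z(3) unfolding H_def inj_on_def by blast
      qed
      have "dec g = x"
      proof
        show "dec g \<subseteq> x"
        proof
          fix a assume "a \<in> dec g"
          then obtain q \<zeta> s where "a \<in> q" "(\<zeta>, s) \<in> g" "q \<in> under |Q \<zeta>| (y \<inter> P \<zeta>)" "h \<zeta> (y \<inter> P \<zeta>) q = s"
            unfolding dec_def by blast
          then show "a \<in> x" using only by blast
        qed
        show "x \<subseteq> dec g"
        proof
          fix a assume a: "a \<in> x"
          then have "a \<in> S" using x unfolding subsets_upto_def by blast
          then obtain j where j: "j \<in> Field \<tau>" "a \<in> U j" using cover by blast
          then obtain \<zeta> where z: "\<zeta> \<in> X" "j \<in> underS \<tau> \<zeta>" "H \<zeta> \<in> U i" using i(2) by blast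
          have "a \<in> x \<inter> P \<zeta>" using a j(2) z(2) unfolding P_def by blast
          moreover have "(\<zeta>, H \<zeta>) \<in> g" using z unfolding g_def by blast
          ultimately show "a \<in> dec g" using xu[OF z(1)] unfolding dec_def H_def by blast
        qed
      qed
      then show "x \<in> dec ` (\<Union>i\<in>Field \<tau>. subsets_upto \<kappa> (Field \<tau> \<times> U i))" using gin i(1) by blast
    qed
    moreover have "|\<Union>i\<in>Field \<tau>. subsets_upto \<kappa> (Field \<tau> \<times> U i)| \<le>o |S|"
    proof (rule UNION_Cinfinite_bound[OF Field_tau_S _ S_inf], rule ballI)
      fix i assume i: "i \<in> Field \<tau>"
      have Ui: "infinite (U i)" by (rule inf_if[OF large[OF i]])
      have "|Field \<tau>| \<le>o |U i|"
        by (rule ordLeq_transitive[OF ordIso_ordLeq_trans[OF Field_tau tau(4)]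
              ordLeq_transitive[OF ordLess_imp_ordLeq[OF less_ctwo_cexp[OF kappa]] large[OF i]]])
      then have "|Field \<tau> \<times> U i| \<le>o |U i|"
        using card_of_Times_ordLeq_infinite_Field[of "|U i|" "Field \<tau>" "U i"] Ui
          ordLeq_refl[OF card_of_Card_order, of "U i"]
        by (simp add: Field_card_of card_of_card_order_on)
      then have "|subsets_upto \<kappa> (Field \<tau> \<times> U i)| \<le>o |subsets_upto \<kappa> (U i)|"
        by (rule card_of_subsets_upto_mono)
      also have "|subsets_upto \<kappa> (U i)| \<le>o cardSuc |U i|"
        by (rule below[OF U_sub[OF i] large[OF i] U_small[OF i]])
      also have "cardSuc |U i| \<le>o |S|" by (rule cardSuc_le_of_less[OF U_small[OF i]])
      finally show "|subsets_upto \<kappa> (Field \<tau> \<times> U i)| \<le>o |S|" .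
    qed
    ultimately show "|{x \<in> subsets_upto \<kappa> S. R x y}| \<le>o |S|"
      using ordLeq_transitive[OF card_of_mono1 ordLeq_transitive[OF card_of_image]] by blast
  qed
qed

section \<open>The ideal and the level bounding principle\<close>

lemma partition_relE:
  fixes F :: "'x list \<Rightarrow> 'r"
  assumes part: "partition_rel S X Y J n \<rho>" and A: "A \<in> X"
    and F: "\<And>as. length as = n \<Longrightarrow> set as \<subseteq> S \<Longrightarrow> F as \<in> Field \<rho>"
  obtains i B Z where "i \<in> Field \<rho>" "B \<in> ideal_pos S J" "B \<subseteq> A" "\<And>a. a \<in> B \<Longrightarrow> Z a \<in> Y"
    "\<And>as. length as = n \<Longrightarrow> set as \<subseteq> B \<Longrightarrow>
       (\<And>m. 1 \<le> m \<Longrightarrow> m < n \<Longrightarrow> as ! m \<notin> (\<Union>j<m. Z (as ! j))) \<Longrightarrow> F as = i"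
proof -
  have "\<forall>A\<in>X. \<exists>i\<in>Field \<rho>. \<exists>B \<in> ideal_pos S J \<inter> Pow A. \<exists>Z :: 'x \<Rightarrow> 'x set.
          (\<forall>a\<in>B. Z a \<in> Y) \<and>
          (\<forall>as. length as = n \<and> set as \<subseteq> B \<and>
                (\<forall>m. 1 \<le> m \<and> m < n \<longrightarrow> as ! m \<notin> (\<Union>j<m. Z (as ! j))) \<longrightarrow>
                F as = i)"
    by (rule mp[OF spec[OF part[unfolded partition_rel_def], of F]]) (use F in simp)
  from bspec[OF this A] obtain i B Z where iBZ: "i \<in> Field \<rho>" "B \<in> ideal_pos S J \<inter> Pow A" "\<forall>a\<in>B. Z a \<in> Y"
    "\<forall>as. length as = n \<and> set as \<subseteq> B \<and>
                (\<forall>m. 1 \<le> m \<and> m < n \<longrightarrow> as ! m \<notin> (\<Union>j<m. Z (as ! j))) \<longrightarrow> F as = i"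
    by (elim bexE exE conjE)
  show ?thesis
    by (rule that[of i B Z]) (use iBZ in simp_all)
qed

lemma distributiveE:
  fixes Q :: "'r \<Rightarrow> 'x set set"
  assumes dist: "distributive S J \<rho> \<nu>" and A: "A \<in> ideal_pos S J"
    and Q: "\<And>\<alpha>. \<alpha> \<in> Field \<rho> \<Longrightarrow> Q \<alpha> \<in> MAD S J \<and> |Q \<alpha>| \<le>o \<nu>"
  obtains B h where "B \<in> ideal_pos S J" "B \<subseteq> A" "\<And>\<alpha>. \<alpha> \<in> Field \<rho> \<Longrightarrow> h \<alpha> \<in> Q \<alpha>"
    "\<And>\<alpha>. \<alpha> \<in> Field \<rho> \<Longrightarrow> B - h \<alpha> \<in> J"
proof -
  have "\<exists>B \<in> ideal_pos S J \<inter> Pow A. \<exists>h :: 'r \<Rightarrow> 'x set.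
          (\<forall>\<alpha>\<in>Field \<rho>. h \<alpha> \<in> Q \<alpha>) \<and> (\<forall>\<alpha>\<in>Field \<rho>. B - h \<alpha> \<in> J)"
    by (rule mp[OF spec[OF bspec[OF dist[unfolded distributive_def] A], of Q]]) (use Q in blast)
  then obtain B h where "B \<in> ideal_pos S J \<inter> Pow A" "\<forall>\<alpha>\<in>Field \<rho>. h \<alpha> \<in> Q \<alpha>"
    "\<forall>\<alpha>\<in>Field \<rho>. B - h \<alpha> \<in> J"
    by (elim bexE exE conjE)
  then show ?thesis by (intro that[of B h]) simp_all
qed

text \<open>
  A set \<open>D\<close> in the dual of the nonstationary ideal enters the proof only through a club \<open>C\<close> inside it.
\<close>

locale club_ideal =
  fixes \<kappa> :: "'k rel" and \<Lambda> :: "'l rel" and C D :: "'l set set" and J :: "'l set set set"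
  assumes kappa: "Card_order \<kappa>" "natLeq <o \<kappa>" "regularCard \<kappa>"
    and Lam: "Card_order \<Lambda>" "\<kappa> \<le>o \<Lambda>" "ctwo ^c \<kappa> \<le>o \<Lambda>"
    and C_club: "club \<kappa> \<Lambda> C" "C \<subseteq> D"
    and D_sub: "D \<subseteq> Pkl \<kappa> \<Lambda>"
    and J_def: "J = ideal_restrict (Pkl \<kappa> \<Lambda>) (I_ideal \<kappa> \<Lambda>) D"
begin

abbreviation "PK \<equiv> Pkl \<kappa> \<Lambda>"
abbreviation "J_pos \<equiv> ideal_pos PK J"

lemma kappa_inf: "Cinfinite \<kappa>"
  using kappa(1) cinfinite_mono[OF ordLess_imp_ordLeq[OF kappa(2)] natLeq_cinfinite] by simp

lemma Lam_inf: "Cinfinite \<Lambda>"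
  using Lam(1) cinfinite_mono[OF Lam(2)] kappa_inf by simp

lemma in_J_iff: "Z \<in> J \<longleftrightarrow> Z \<subseteq> PK \<and> (\<exists>a\<in>PK. \<forall>b\<in>Z \<inter> D. \<not> a \<subseteq> b)"
  unfolding J_def ideal_restrict_def I_ideal_def using D_sub by blast

lemma pos_iff: "A \<in> J_pos \<longleftrightarrow> A \<subseteq> PK \<and> (\<forall>a\<in>PK. \<exists>b\<in>A \<inter> D. a \<subseteq> b)"
  unfolding ideal_pos_def in_J_iff by blast

lemma D_pos: "D \<in> J_pos"
  unfolding pos_iff
proof (intro conjI ballI)
  show "D \<subseteq> PK" by (rule D_sub)
  fix a assume "a \<in> PK"
  then obtain b where "b \<in> C" "a \<subseteq> b" using C_club(1) unfolding club_def by metis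
  then show "\<exists>b\<in>D \<inter> D. a \<subseteq> b" using C_club(2) by blast
qed

lemma J_subset: "Z \<in> J \<Longrightarrow> Z' \<subseteq> Z \<Longrightarrow> Z' \<in> J"
  unfolding in_J_iff by blast

lemma small_Union_in_PK:
  assumes "|I| <o \<kappa>" "\<And>i. i \<in> I \<Longrightarrow> a i \<in> PK"
  shows "(\<Union>i\<in>I. a i) \<in> PK"
proof -
  have "|\<Union>i\<in>I. a i| <o \<kappa>"
    by (rule card_of_UNION_ordLess_infinite_Field_regularCard[OF kappa(3) kappa_inf assms(1)])
      (use assms(2) in \<open>simp add: Pkl_def\<close>)
  then show ?thesis using assms(2) unfolding Pkl_def by blast
qed

lemma finite_in_PK: "finite a \<Longrightarrow> a \<subseteq> Field \<Lambda> \<Longrightarrow> a \<in> PK"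
  using finite_less_Cinfinite[OF kappa_inf, of a] unfolding Pkl_def by simp

lemma Un_in_PK: "a \<in> PK \<Longrightarrow> b \<in> PK \<Longrightarrow> a \<union> b \<in> PK"
  unfolding Pkl_def using Un_Cinfinite_bound_strict[OF _ _ kappa_inf, of a b] by simp

lemma small_Union_in_J:
  assumes I: "|I| <o \<kappa>" and Z: "\<And>i. i \<in> I \<Longrightarrow> Z i \<in> J"
  shows "(\<Union>i\<in>I. Z i) \<in> J"
proof -
  have "\<forall>i\<in>I. \<exists>a\<in>PK. \<forall>b\<in>Z i \<inter> D. \<not> a \<subseteq> b" using Z unfolding in_J_iff by blast
  then obtain a where a: "\<And>i. i \<in> I \<Longrightarrow> a i \<in> PK" "\<And>i b. i \<in> I \<Longrightarrow> b \<in> Z i \<inter> D \<Longrightarrow> \<not> a i \<subseteq> b"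
    by metis
  have "(\<Union>i\<in>I. a i) \<in> PK" by (rule small_Union_in_PK[OF I a(1)])
  moreover have "\<forall>b\<in>(\<Union>i\<in>I. Z i) \<inter> D. \<not> (\<Union>i\<in>I. a i) \<subseteq> b" using a(2) by blast
  ultimately show ?thesis using Z unfolding in_J_iff by blast
qed

lemma nat_small: "|UNIV :: nat set| <o \<kappa>"
  by (rule ordIso_ordLess_trans[OF card_of_nat kappa(2)])

lemma countable_Union_in_J: "(\<And>n::nat. Z n \<in> J) \<Longrightarrow> (\<Union>n. Z n) \<in> J"
  using small_Union_in_J[OF nat_small] by blast

lemma Un_in_J: "Z \<in> J \<Longrightarrow> Z' \<in> J \<Longrightarrow> Z \<union> Z' \<in> J"
  using small_Union_in_J[OF finite_less_Cinfinite[OF kappa_inf], of UNIV "\<lambda>b. if b then Z else Z'"]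
  by (auto simp: UNIV_bool Un_commute)

lemma empty_in_J: "{} \<in> J"
  using finite_in_PK[of "{}"] unfolding in_J_iff by blast

lemma pos_diff: "A \<in> J_pos \<Longrightarrow> Z \<in> J \<Longrightarrow> A - Z \<in> J_pos"
  using Un_in_J[of "A - Z" Z] J_subset[of "(A - Z) \<union> Z" A] unfolding ideal_pos_def by blast

lemma pos_nonempty: "A \<in> J_pos \<Longrightarrow> A \<noteq> {}"
  using empty_in_J unfolding ideal_pos_def by blast

lemma pos_countable_split:
  assumes "A \<in> J_pos" shows "\<exists>n::nat. {a \<in> A. f a = n} \<in> J_pos"
proof (rule ccontr)
  assume "\<not> ?thesis"
  then have "{a \<in> A. f a = n} \<in> J" for n using assms unfolding ideal_pos_def by blast
  then have "(\<Union>n. {a \<in> A. f a = n}) \<in> J" by (rule countable_Union_in_J)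
  moreover have "(\<Union>n. {a \<in> A. f a = n}) = A" by blast
  ultimately show False using assms unfolding ideal_pos_def by simp
qed

text \<open>
  The common consequence of the three partition and distributivity properties. Only \<open>a\<close> goes through
  \<open>\<phi>\<close> into \<open>\<Lambda>\<close>, since \<open>(\<lambda>, 2)\<close>-distributivity decides only \<open>\<lambda>\<close> many sets at once whereas \<open>P\<^sub>\<kappa>(\<lambda>)\<close> may
  have more than \<open>\<lambda>\<close> elements.
\<close>

definition level_bounding :: bool where
  "level_bounding \<longleftrightarrow> (\<forall>A\<in>J_pos. \<forall>\<phi> (G :: 'l \<Rightarrow> 'l set \<Rightarrow> nat). (\<forall>a\<in>PK. \<phi> a \<in> Field \<Lambda>) \<longrightarrow>
     (\<exists>B\<in>J_pos. B \<subseteq> A \<and> (\<exists>n. \<forall>a\<in>B. {b \<in> B. n < G (\<phi> a) b} \<in> J)))"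

lemma level_bounding_if_pairs:
  assumes "partition_rel PK J_pos J J 2 natLeq"
  shows level_bounding
  unfolding level_bounding_def
proof (intro ballI allI impI)
  fix A \<phi> and G :: "'l \<Rightarrow> 'l set \<Rightarrow> nat"
  assume A: "A \<in> J_pos"
  define F where "F = (\<lambda>as. G (\<phi> (as ! 0)) (as ! 1))"
  obtain i B Z where "i \<in> Field natLeq" and B: "B \<in> J_pos" "B \<subseteq> A" and Z: "\<And>a. a \<in> B \<Longrightarrow> Z a \<in> J"
    and hom: "\<And>as. length as = 2 \<Longrightarrow> set as \<subseteq> B \<Longrightarrow>
        (\<And>m. 1 \<le> m \<Longrightarrow> m < 2 \<Longrightarrow> as ! m \<notin> (\<Union>j<m. Z (as ! j))) \<Longrightarrow> F as = i"
    by (rule partition_relE[OF assms A, of F]) (simp add: Field_natLeq, blast)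
  have "{b \<in> B. i < G (\<phi> a) b} \<in> J" if a: "a \<in> B" for a
  proof -
    have "G (\<phi> a) b = i" if b: "b \<in> B" "b \<notin> Z a" for b
    proof -
      have "[a, b] ! m \<notin> (\<Union>j<m. Z ([a, b] ! j))" if "1 \<le> m" "m < 2" for m
      proof -
        have "m = 1" using that by simp
        then show ?thesis using b(2) by simp
      qed
      then have "F [a, b] = i" by (intro hom) (use a b in auto)
      then show ?thesis unfolding F_def by simp
    qed
    then have "{b \<in> B. i < G (\<phi> a) b} \<subseteq> Z a" by fastforce
    then show ?thesis using Z a J_subset by blast
  qed
  then show "\<exists>B\<in>J_pos. B \<subseteq> A \<and> (\<exists>n. \<forall>a\<in>B. {b \<in> B. n < G (\<phi> a) b} \<in> J)"
    using B by blast
qed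

text \<open>
  Colour \<open>(a, b, c)\<close> by the truth value of \<open>G (\<phi> b) c \<le> G (\<phi> a) c\<close>. If the homogeneous colour is false, then
  \<open>G (\<phi> a) c < G (\<phi> b) c\<close> for \<open>J\<close>-almost all \<open>b\<close> and then \<open>J\<close>-almost all \<open>c\<close>, and induction on \<open>m\<close> gives
  \<open>m \<le> G (\<phi> b) c\<close> for almost all \<open>b\<close> and almost all \<open>c\<close>; as \<open>J\<close> is countably complete, this holds for all \<open>m\<close>
  at once, which is absurd. If the colour is true, then the values of \<open>G\<close> at one fixed \<open>a\<close> bound all others,
  and they are constant on a positive set.
\<close>

lemma level_bounding_if_triples:
  assumes "partition_rel PK J_pos J J 3 ctwo"
  shows level_bounding
  unfolding level_bounding_def
proof (intro ballI allI impI)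
  fix A \<phi> and G :: "'l \<Rightarrow> 'l set \<Rightarrow> nat"
  assume A: "A \<in> J_pos"
  define F where "F = (\<lambda>as. G (\<phi> (as ! 1)) (as ! 2) \<le> G (\<phi> (as ! 0)) (as ! 2))"
  obtain i B Z where "i \<in> Field ctwo" and Bpos: "B \<in> J_pos" and B: "B \<subseteq> A" and Z: "\<And>a. a \<in> B \<Longrightarrow> Z a \<in> J"
    and hom: "\<And>as. length as = 3 \<Longrightarrow> set as \<subseteq> B \<Longrightarrow>
        (\<And>m. 1 \<le> m \<Longrightarrow> m < 3 \<Longrightarrow> as ! m \<notin> (\<Union>j<m. Z (as ! j))) \<Longrightarrow> F as = i"
    by (rule partition_relE[OF assms A, of F]) (simp add: ctwo_def Field_card_of, blast)
  have col: "(G (\<phi> b) c \<le> G (\<phi> a) c) = i"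
    if abc: "a \<in> B" "b \<in> B" "c \<in> B" "b \<notin> Z a" "c \<notin> Z a" "c \<notin> Z b" for a b c
  proof -
    have "[a, b, c] ! m \<notin> (\<Union>j<m. Z ([a, b, c] ! j))" if "1 \<le> m" "m < 3" for m
    proof -
      have "m = 1 \<or> m = 2" using that by linarith
      then show ?thesis using abc by (auto simp: less_Suc_eq numeral_2_eq_2)
    qed
    then have "F [a, b, c] = i" by (intro hom) (use abc in auto)
    then show ?thesis unfolding F_def by simp
  qed
  have i: i
  proof (rule ccontr)
    assume "\<not> i"
    then have less: "G (\<phi> a) c < G (\<phi> b) c"
      if "a \<in> B" "b \<in> B" "c \<in> B" "b \<notin> Z a" "c \<notin> Z a" "c \<notin> Z b" for a b c
      using col[OF that] by simp
    have step: "{b \<in> B. {c \<in> B. G (\<phi> b) c < m} \<notin> J} \<in> J" for m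
    proof (induction m)
      case 0
      then show ?case using empty_in_J by simp
    next
      case (Suc m)
      obtain a where a: "a \<in> B" "{c \<in> B. G (\<phi> a) c < m} \<in> J"
        using pos_nonempty[OF pos_diff[OF Bpos Suc.IH]] by blast
      have "{c \<in> B. G (\<phi> b) c < Suc m} \<in> J" if b: "b \<in> B" "b \<notin> Z a" for b
      proof (rule J_subset)
        show "Z a \<union> Z b \<union> {c \<in> B. G (\<phi> a) c < m} \<in> J"
          using Z a b by (intro Un_in_J) auto
        show "{c \<in> B. G (\<phi> b) c < Suc m} \<subseteq> Z a \<union> Z b \<union> {c \<in> B. G (\<phi> a) c < m}"
          using less[OF a(1) b(1) _ b(2)] by fastforce
      qed
      then have "{b \<in> B. {c \<in> B. G (\<phi> b) c < Suc m} \<notin> J} \<subseteq> Z a" by blast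
      then show ?case using Z a(1) J_subset by blast
    qed
    have "(\<Union>m. {b \<in> B. {c \<in> B. G (\<phi> b) c < m} \<notin> J}) \<in> J"
      using countable_Union_in_J[OF step] .
    then obtain b where b: "b \<in> B" "\<And>m. {c \<in> B. G (\<phi> b) c < m} \<in> J"
      using pos_nonempty[OF pos_diff[OF Bpos]] by blast
    have "(\<Union>m. {c \<in> B. G (\<phi> b) c < m}) \<in> J" using countable_Union_in_J[OF b(2)] .
    moreover have "(\<Union>m. {c \<in> B. G (\<phi> b) c < m}) = B" by blast
    ultimately show False using Bpos unfolding ideal_pos_def by simp
  qed
  obtain a where a: "a \<in> B" using pos_nonempty[OF Bpos] by blast
  have "B - Z a \<in> J_pos" using pos_diff[OF Bpos] Z a by blast
  then obtain n where n: "{c \<in> B - Z a. G (\<phi> a) c = n} \<in> J_pos"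
    using pos_countable_split[of "B - Z a" "G (\<phi> a)"] by blast
  define B' where "B' = {c \<in> B - Z a. G (\<phi> a) c = n}"
  have "{c \<in> B'. n < G (\<phi> b) c} \<in> J" if b: "b \<in> B'" for b
  proof -
    have "{c \<in> B'. n < G (\<phi> b) c} \<subseteq> Z b"
      using col[OF a, of b] b i unfolding B'_def by fastforce
    then show ?thesis using Z b J_subset unfolding B'_def by blast
  qed
  then have "\<exists>n. \<forall>a\<in>B'. {b \<in> B'. n < G (\<phi> a) b} \<in> J" by blast
  moreover have "B' \<in> J_pos" "B' \<subseteq> A" using n B unfolding B'_def by auto
  ultimately show "\<exists>B\<in>J_pos. B \<subseteq> A \<and> (\<exists>n. \<forall>a\<in>B. {b \<in> B. n < G (\<phi> a) b} \<in> J)" by blast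
qed

text \<open>
  Apply distributivity to the partitions of \<open>P\<^sub>\<kappa>(\<lambda>)\<close> into \<open>{b. G x b \<le> m}\<close> and its complement, indexed by
  \<open>\<lambda> \<times> \<omega>\<close>, that is, by \<open>\<lambda>\<close>. By countable completeness, some \<open>N x\<close> bounds \<open>G x b\<close> for almost all \<open>b\<close>, and
  \<open>N (\<phi> a)\<close> is constant on a positive set of \<open>a\<close>.
\<close>

lemma level_bounding_if_distributive:
  assumes "distributive PK J \<Lambda> ctwo"
  shows level_bounding
  unfolding level_bounding_def
proof (intro ballI allI impI)
  fix A \<phi> and G :: "'l \<Rightarrow> 'l set \<Rightarrow> nat"
  assume A: "A \<in> J_pos" and phi: "\<forall>a\<in>PK. \<phi> a \<in> Field \<Lambda>"
  have "|Field \<Lambda> \<times> (UNIV :: nat set)| \<le>o \<Lambda>"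
    using card_of_Times_ordLeq_infinite_Field[of \<Lambda> "Field \<Lambda>" "UNIV :: nat set"] Lam_inf
      ordIso_imp_ordLeq[OF card_of_Field_ordIso] ordLess_imp_ordLeq[OF ordLess_ordLeq_trans[OF nat_small Lam(2)]]
    unfolding cinfinite_def by blast
  then have "|Field \<Lambda> \<times> (UNIV :: nat set)| \<le>o |Field \<Lambda>|"
    using ordLeq_ordIso_trans[OF _ ordIso_symmetric[OF card_of_Field_ordIso[OF Lam(1)]]] by blast
  then obtain p where p: "inj_on p (Field \<Lambda> \<times> (UNIV :: nat set))" "p ` (Field \<Lambda> \<times> UNIV) \<subseteq> Field \<Lambda>"
    unfolding card_of_ordLeq[symmetric] by blast
  define u where "u = inv_into (Field \<Lambda> \<times> (UNIV :: nat set)) p"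
  define W where "W = (\<lambda>\<alpha>. {b \<in> PK. G (fst (u \<alpha>)) b \<le> snd (u \<alpha>)})"
  \<comment> \<open>A cell in \<open>J\<close> must be dropped, as the members of a maximal antichain are positive.\<close>
  define Q where "Q = (\<lambda>\<alpha>. {W \<alpha>, PK - W \<alpha>} \<inter> J_pos)"
  have "Q \<alpha> \<in> MAD PK J \<and> |Q \<alpha>| \<le>o ctwo" for \<alpha>
  proof
    have "\<exists>E\<in>Q \<alpha>. E \<inter> C \<in> J_pos" if C: "C \<in> J_pos" for C
    proof -
      have CP: "C \<subseteq> PK" using C unfolding ideal_pos_def by blast
      have "W \<alpha> \<inter> C \<in> J_pos \<or> (PK - W \<alpha>) \<inter> C \<in> J_pos"
      proof (rule ccontr)
        assume "\<not> ?thesis"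
        then have "W \<alpha> \<inter> C \<in> J" "(PK - W \<alpha>) \<inter> C \<in> J" using CP unfolding ideal_pos_def by blast+
        then have "(W \<alpha> \<inter> C) \<union> ((PK - W \<alpha>) \<inter> C) \<in> J" by (rule Un_in_J)
        then have "C \<in> J" by (rule J_subset) (use CP in blast)
        then show False using C unfolding ideal_pos_def by blast
      qed
      moreover have "E \<in> J_pos" if "E \<subseteq> PK" "E \<inter> C \<in> J_pos" for E
        using that J_subset[of E "E \<inter> C"] unfolding ideal_pos_def by blast
      moreover have "W \<alpha> \<subseteq> PK" unfolding W_def by blast
      ultimately show ?thesis unfolding Q_def by blast
    qed
    moreover have "E \<inter> E' \<in> J" if "E \<in> Q \<alpha>" "E' \<in> Q \<alpha>" "E \<noteq> E'" for E E'
    proof -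
      have "E \<inter> E' = {}" using that unfolding Q_def by blast
      then show ?thesis using empty_in_J by simp
    qed
    moreover have "Q \<alpha> \<subseteq> J_pos" unfolding Q_def by blast
    ultimately show "Q \<alpha> \<in> MAD PK J" unfolding MAD_def by blast
    have "inj_on (\<lambda>E. E = W \<alpha>) (Q \<alpha>)" unfolding Q_def inj_on_def by blast
    then show "|Q \<alpha>| \<le>o ctwo" unfolding ctwo_def by (rule card_of_ordLeqI) simp
  qed
  then obtain B h where Bpos: "B \<in> J_pos" and B: "B \<subseteq> A"
    and h: "\<And>\<alpha>. \<alpha> \<in> Field \<Lambda> \<Longrightarrow> h \<alpha> \<in> Q \<alpha>" "\<And>\<alpha>. \<alpha> \<in> Field \<Lambda> \<Longrightarrow> B - h \<alpha> \<in> J"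
    by (rule distributiveE[OF assms A, of Q]) blast
  then have BP: "B \<subseteq> PK" unfolding ideal_pos_def by blast
  have decide: "{b \<in> B. m < G x b} \<in> J \<or> {b \<in> B. G x b \<le> m} \<in> J" if x: "x \<in> Field \<Lambda>" for x m
  proof -
    have pF: "p (x, m) \<in> Field \<Lambda>" using p(2) x by blast
    have u: "u (p (x, m)) = (x, m)" unfolding u_def using inv_into_f_f[OF p(1)] x by blast
    have eq: "B - W (p (x, m)) = {b \<in> B. m < G x b}" "B - (PK - W (p (x, m))) = {b \<in> B. G x b \<le> m}"
      unfolding W_def u using BP by auto
    have "h (p (x, m)) = W (p (x, m)) \<or> h (p (x, m)) = PK - W (p (x, m))"
      using h(1) pF unfolding Q_def by blast
    then show ?thesis using h(2) pF eq by metis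
  qed
  have "\<exists>m. {b \<in> B. m < G x b} \<in> J" if x: "x \<in> Field \<Lambda>" for x
  proof (rule ccontr)
    assume "\<not> ?thesis"
    then have "{b \<in> B. G x b \<le> m} \<in> J" for m using decide[OF x] by blast
    then have "(\<Union>m. {b \<in> B. G x b \<le> m}) \<in> J" by (rule countable_Union_in_J)
    moreover have "(\<Union>m. {b \<in> B. G x b \<le> m}) = B" by blast
    ultimately show False using Bpos unfolding ideal_pos_def by simp
  qed
  then obtain N where N: "\<And>x. x \<in> Field \<Lambda> \<Longrightarrow> {b \<in> B. N x < G x b} \<in> J" by metis
  obtain n where n: "{a \<in> B. N (\<phi> a) = n} \<in> J_pos"
    using pos_countable_split[OF Bpos, of "\<lambda>a. N (\<phi> a)"] by (elim exE)
  define B' where "B' = {a \<in> B. N (\<phi> a) = n}"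
  have "{b \<in> B'. n < G (\<phi> a) b} \<in> J" if a: "a \<in> B'" for a
  proof (rule J_subset)
    have "a \<in> PK" using a BP unfolding B'_def by blast
    then show "{b \<in> B. N (\<phi> a) < G (\<phi> a) b} \<in> J" using N phi by simp
    show "{b \<in> B'. n < G (\<phi> a) b} \<subseteq> {b \<in> B. N (\<phi> a) < G (\<phi> a) b}"
      using a unfolding B'_def by auto
  qed
  then have "\<exists>n. \<forall>a\<in>B'. {b \<in> B'. n < G (\<phi> a) b} \<in> J" by blast
  moreover have "B' \<in> J_pos" "B' \<subseteq> A" using n B unfolding B'_def by auto
  ultimately show "\<exists>B\<in>J_pos. B \<subseteq> A \<and> (\<exists>n. \<forall>a\<in>B. {b \<in> B. n < G (\<phi> a) b} \<in> J)" by blast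
qed

text \<open>
  View \<open>r\<close> as a subset of \<open>\<Lambda>\<close>, and let \<open>\<phi> a\<close> be a strict upper bound of the part of \<open>a\<close> that lies in \<open>r\<close>. It
  converges to the top of \<open>r\<close> along \<open>J\<close>, so that its image of a positive set is unbounded.
\<close>

lemma ex_rank_function:
  fixes r :: "'r rel"
  assumes r: "Cinfinite r" "regularCard r" "\<kappa> \<le>o r" "r \<le>o \<Lambda>"
  obtains \<phi> where "\<And>a. a \<in> PK \<Longrightarrow> \<phi> a \<in> Field r"
    "\<And>\<gamma>. \<gamma> \<in> Field r \<Longrightarrow> {b \<in> PK. \<gamma> \<notin> underS r (\<phi> b)} \<in> J"
proof -
  have "|Field r| \<le>o |Field \<Lambda>|"
    using card_of_mono2[OF r(4)] .
  then obtain \<iota> where iota: "inj_on \<iota> (Field r)" "\<iota> ` Field r \<subseteq> Field \<Lambda>"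
    unfolding card_of_ordLeq[symmetric] by blast
  have "\<exists>u. u \<in> Field r \<and> (\<forall>\<gamma>\<in>Field r. \<iota> \<gamma> \<in> a \<longrightarrow> \<gamma> \<in> underS r u)" if a: "a \<in> PK" for a
  proof -
    let ?Z = "{\<gamma> \<in> Field r. \<iota> \<gamma> \<in> a}"
    have "inj_on \<iota> ?Z" using iota(1) unfolding inj_on_def by blast
    then have "|?Z| \<le>o |a|" by (rule card_of_ordLeqI) blast
    moreover have "|a| <o r" using a ordLess_ordLeq_trans[OF _ r(3)] unfolding Pkl_def by blast
    ultimately have "|?Z| <o r" by (rule ordLeq_ordLess_trans)
    moreover have "?Z \<subseteq> Field r" by blast
    ultimately obtain u where "u \<in> Field r" "\<And>z. z \<in> ?Z \<Longrightarrow> z \<in> underS r u"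
      using strict_bound_of_small[OF r(1,2), of ?Z] by blast
    then show ?thesis by blast
  qed
  then obtain \<phi> where phi: "\<And>a. a \<in> PK \<Longrightarrow> \<phi> a \<in> Field r"
    "\<And>a \<gamma>. a \<in> PK \<Longrightarrow> \<gamma> \<in> Field r \<Longrightarrow> \<iota> \<gamma> \<in> a \<Longrightarrow> \<gamma> \<in> underS r (\<phi> a)"
    by metis
  have "{b \<in> PK. \<gamma> \<notin> underS r (\<phi> b)} \<in> J" if g: "\<gamma> \<in> Field r" for \<gamma>
  proof -
    have "{\<iota> \<gamma>} \<in> PK" using finite_in_PK iota(2) g by blast
    moreover have "\<not> {\<iota> \<gamma>} \<subseteq> b" if "b \<in> {b \<in> PK. \<gamma> \<notin> underS r (\<phi> b)} \<inter> D" for b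
      using that phi(2) g by blast
    ultimately show ?thesis unfolding in_J_iff by blast
  qed
  then show ?thesis using that phi(1) by blast
qed

text \<open>
  The form in which the principle is applied: it yields \<open>r\<close> many elements \<open>\<gamma>\<close> of a regular cardinal \<open>r\<close>
  with one common bound on \<open>G \<gamma> b\<close>, valid for almost all \<open>b\<close>.
\<close>

lemma level_bounding_regular:
  fixes r :: "'r rel" and G :: "'r \<Rightarrow> 'l set \<Rightarrow> nat"
  assumes lb: level_bounding and A: "A \<in> J_pos"
    and r: "regularCard r" "r \<le>o \<Lambda>"
    and phi: "\<And>a. a \<in> PK \<Longrightarrow> \<phi> a \<in> Field r"
      "\<And>\<gamma>. \<gamma> \<in> Field r \<Longrightarrow> {b \<in> PK. \<gamma> \<notin> underS r (\<phi> b)} \<in> J"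
  obtains B n where "B \<in> J_pos" "B \<subseteq> A" "\<phi> ` B \<subseteq> Field r" "|\<phi> ` B| =o r"
    "\<And>\<gamma>. \<gamma> \<in> \<phi> ` B \<Longrightarrow> {b \<in> B. n < G \<gamma> b} \<in> J"
proof -
  have "|Field r| \<le>o |Field \<Lambda>|"
    using card_of_mono2[OF r(2)] .
  then obtain \<iota> where iota: "inj_on \<iota> (Field r)" "\<iota> ` Field r \<subseteq> Field \<Lambda>"
    unfolding card_of_ordLeq[symmetric] by blast
  have "\<forall>a\<in>PK. \<iota> (\<phi> a) \<in> Field \<Lambda>" using phi(1) iota(2) by blast
  then obtain B n where B: "B \<in> J_pos" "B \<subseteq> A"
    and bound: "\<And>a. a \<in> B \<Longrightarrow> {b \<in> B. n < G (inv_into (Field r) \<iota> (\<iota> (\<phi> a))) b} \<in> J"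
    using lb[unfolded level_bounding_def, rule_format, OF A, of "\<lambda>a. \<iota> (\<phi> a)" "\<lambda>x. G (inv_into (Field r) \<iota> x)"]
    by blast
  have BP: "B \<subseteq> PK" using B(1) unfolding ideal_pos_def by blast
  have sub: "\<phi> ` B \<subseteq> Field r" using phi(1) BP by blast
  have "cofinal (\<phi> ` B) r"
    unfolding cofinal_def
  proof
    fix \<gamma> assume "\<gamma> \<in> Field r"
    then obtain b where "b \<in> B" "\<gamma> \<in> underS r (\<phi> b)"
      using pos_nonempty[OF pos_diff[OF B(1) phi(2)]] BP by blast
    then show "\<exists>b\<in>\<phi> ` B. \<gamma> \<noteq> b \<and> (\<gamma>, b) \<in> r" unfolding underS_def by blast
  qed
  then have size: "|\<phi> ` B| =o r" using sub r(1) unfolding regularCard_def by blast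
  have "{b \<in> B. n < G \<gamma> b} \<in> J" if "\<gamma> \<in> \<phi> ` B" for \<gamma>
    using that bound inv_into_f_f[OF iota(1)] sub by force
  then show ?thesis using that[OF B sub size] by blast
qed

section \<open>Powers of cardinals below \<open>\<lambda>\<close>\<close>

text \<open>
  Let \<open>r = |S|\<^sup>+\<close>, and split each \<open>\<beta> < r\<close> into an increasing sequence of sets of size less than \<open>|S|\<close>, by an
  injection into \<open>S = \<Union>\<^sub>n V n\<close>. Let \<open>G \<gamma> b\<close> be the index at which \<open>\<gamma>\<close> enters the sequence for \<open>\<phi> b\<close>. The
  principle gives a set \<open>\<Gamma>\<close> of size \<open>r\<close> and an \<open>n\<close> such that, by \<open>\<kappa>\<close>-completeness of \<open>J\<close>, every countable
  subset of \<open>\<Gamma>\<close> lies in the \<open>n\<close>-th set for some \<open>\<beta>\<close>. Hence \<open>\<Gamma>\<close> has at most \<open>r\<close> countable subsets. A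
  small subset \<open>y\<close> of \<open>S\<close> is in turn determined by the countable set of codes in \<open>\<Gamma>\<close> of its traces on the \<open>V m\<close>.
\<close>

lemma card_of_subsets_upto_countable_cofinality:
  fixes S :: "'l set" and U :: "nat \<Rightarrow> 'l set"
  assumes lb: level_bounding
    and S: "ctwo ^c \<kappa> \<le>o |S|" "|S| <o \<Lambda>"
    and cover: "(\<Union>n. U n) = S" and small: "\<And>n. |U n| <o |S|"
    and below: "\<And>S'. S' \<subseteq> S \<Longrightarrow> |S'| <o |S| \<Longrightarrow> |subsets_upto \<kappa> S'| \<le>o |S|"
  shows "|subsets_upto \<kappa> S| \<le>o cardSuc |S|"
proof -
  have kS: "\<kappa> \<le>o |S|"
    using ordLeq_transitive[OF ordLess_imp_ordLeq[OF less_ctwo_cexp[OF kappa_inf]] S(1)] .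
  have "infinite S"
    using cinfinite_mono[OF kS] kappa_inf unfolding cinfinite_def Field_card_of by blast
  then have Sinf: "Cinfinite |S|" by (rule Cinfinite_card_of)
  define r where "r = cardSuc |S|"
  have rC: "Cinfinite r" unfolding r_def by (rule Cinfinite_cardSuc[OF Sinf])
  have rreg: "regularCard r" unfolding r_def by (rule regularCard_cardSuc[OF Sinf])
  have Sr: "|S| \<le>o r" unfolding r_def by (rule cardSuc_ordLeq[OF card_of_Card_order])
  have kr: "\<kappa> \<le>o r" by (rule ordLeq_transitive[OF kS Sr])
  have rL: "r \<le>o \<Lambda>" unfolding r_def by (rule cardSuc_least[OF card_of_Card_order Lam(1) S(2)])
  have Fr: "|Field r| \<le>o r" using ordIso_imp_ordLeq[OF card_of_Field_ordIso] rC by blast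
  define V where "V = (\<lambda>n. \<Union>m\<in>{..n}. U m)"
  have V_small: "|V n| <o |S|" for n
  proof (induction n)
    case 0
    then show ?case unfolding V_def using small[of 0] by simp
  next
    case (Suc n)
    have "V (Suc n) = V n \<union> U (Suc n)" unfolding V_def by (auto simp: atMost_Suc)
    then show ?case using Un_Cinfinite_bound_strict[OF Suc small Sinf] by simp
  qed
  have V_mono: "V m \<subseteq> V n" if "m \<le> n" for m n
    unfolding V_def using that by fastforce
  have V_sub: "V n \<subseteq> S" for n unfolding V_def using cover by blast
  have V_cover: "\<exists>n. x \<in> V n" if "x \<in> S" for x
    using that cover unfolding V_def by blast
  have "\<exists>f. inj_on f (underS r \<beta>) \<and> f ` underS r \<beta> \<subseteq> S" if b: "\<beta> \<in> Field r" for \<beta>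
  proof -
    have "|underS r \<beta>| <o r" using card_of_underS[of r \<beta>] rC b by blast
    then have "|underS r \<beta>| \<le>o |S|" unfolding r_def by (rule ordLeq_if_less_cardSuc)
    then show ?thesis unfolding card_of_ordLeq[symmetric] .
  qed
  then obtain f where f: "\<And>\<beta>. \<beta> \<in> Field r \<Longrightarrow> inj_on (f \<beta>) (underS r \<beta>)"
    "\<And>\<beta>. \<beta> \<in> Field r \<Longrightarrow> f \<beta> ` underS r \<beta> \<subseteq> S"
    by metis
  obtain \<phi> where phi: "\<And>a. a \<in> PK \<Longrightarrow> \<phi> a \<in> Field r"
    "\<And>\<gamma>. \<gamma> \<in> Field r \<Longrightarrow> {b \<in> PK. \<gamma> \<notin> underS r (\<phi> b)} \<in> J"
    using ex_rank_function[OF rC rreg kr rL] by blast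
  define G where "G = (\<lambda>\<gamma> b. LEAST n. f (\<phi> b) \<gamma> \<in> V n)"
  obtain B n where B: "B \<in> J_pos" "B \<subseteq> D" and Gam: "\<phi> ` B \<subseteq> Field r" "|\<phi> ` B| =o r"
    and bound: "\<And>\<gamma>. \<gamma> \<in> \<phi> ` B \<Longrightarrow> {b \<in> B. n < G \<gamma> b} \<in> J"
    by (rule level_bounding_regular[OF lb D_pos rreg rL phi, of G]) blast+
  have BP: "B \<subseteq> PK" using B(1) unfolding ideal_pos_def by blast
  define \<Gamma> where "\<Gamma> = \<phi> ` B"
  define H where "H = (\<lambda>\<beta>. {\<gamma> \<in> underS r \<beta>. f \<beta> \<gamma> \<in> V n})"
  have countable_sets: "subsets_upto natLeq \<Gamma> \<subseteq> (\<Union>\<beta>\<in>Field r. subsets_upto \<kappa> (H \<beta>))"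
  proof
    fix x assume "x \<in> subsets_upto natLeq \<Gamma>"
    then have x: "x \<subseteq> \<Gamma>" "|x| \<le>o natLeq" unfolding subsets_upto_def by blast+
    have x_small: "|x| <o \<kappa>" by (rule ordLeq_ordLess_trans[OF x(2) kappa(2)])
    have "{b \<in> B. n < G \<gamma> b} \<union> {b \<in> PK. \<gamma> \<notin> underS r (\<phi> b)} \<in> J" if "\<gamma> \<in> x" for \<gamma>
      using that x(1) Gam(1) bound phi(2) unfolding \<Gamma>_def by (intro Un_in_J) auto
    then have "(\<Union>\<gamma>\<in>x. {b \<in> B. n < G \<gamma> b} \<union> {b \<in> PK. \<gamma> \<notin> underS r (\<phi> b)}) \<in> J"
      by (rule small_Union_in_J[OF x_small])
    from pos_nonempty[OF pos_diff[OF B(1) this]]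
    obtain b where bB: "b \<in> B"
      and out: "b \<notin> (\<Union>\<gamma>\<in>x. {b \<in> B. n < G \<gamma> b} \<union> {b \<in> PK. \<gamma> \<notin> underS r (\<phi> b)})"
      by blast
    have "G \<gamma> b \<le> n \<and> \<gamma> \<in> underS r (\<phi> b)" if "\<gamma> \<in> x" for \<gamma>
    proof -
      have "b \<notin> {b \<in> B. n < G \<gamma> b}" "b \<notin> {b \<in> PK. \<gamma> \<notin> underS r (\<phi> b)}" using out that by blast+
      then show ?thesis using bB BP by auto
    qed
    then have b: "b \<in> B" "\<And>\<gamma>. \<gamma> \<in> x \<Longrightarrow> G \<gamma> b \<le> n" "\<And>\<gamma>. \<gamma> \<in> x \<Longrightarrow> \<gamma> \<in> underS r (\<phi> b)"
      using bB by simp_all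
    have pb: "\<phi> b \<in> Field r" using Gam(1) b(1) by blast
    have "f (\<phi> b) \<gamma> \<in> V n" if g: "\<gamma> \<in> x" for \<gamma>
    proof -
      have "f (\<phi> b) \<gamma> \<in> S" using f(2)[OF pb] b(3)[OF g] by blast
      then obtain m where "f (\<phi> b) \<gamma> \<in> V m" using V_cover by blast
      then have "f (\<phi> b) \<gamma> \<in> V (G \<gamma> b)" unfolding G_def by (rule LeastI)
      then show ?thesis using V_mono[OF b(2)[OF g]] by blast
    qed
    then have "x \<in> subsets_upto \<kappa> (H (\<phi> b))"
      using b(3) ordLess_imp_ordLeq[OF x_small] unfolding H_def subsets_upto_def by blast
    then show "x \<in> (\<Union>\<beta>\<in>Field r. subsets_upto \<kappa> (H \<beta>))" using pb by blast
  qed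
  have "|\<Union>\<beta>\<in>Field r. subsets_upto \<kappa> (H \<beta>)| \<le>o r"
  proof (rule UNION_Cinfinite_bound[OF Fr _ rC], rule ballI)
    fix \<beta> assume b: "\<beta> \<in> Field r"
    have "inj_on (f \<beta>) (H \<beta>)" using f(1)[OF b] unfolding H_def inj_on_def by blast
    then have "|H \<beta>| \<le>o |V n|" by (rule card_of_ordLeqI) (simp add: H_def)
    then have "|subsets_upto \<kappa> (H \<beta>)| \<le>o |subsets_upto \<kappa> (V n)|"
      by (rule card_of_subsets_upto_mono)
    also have "|subsets_upto \<kappa> (V n)| \<le>o |S|" by (rule below[OF V_sub V_small])
    also have "|S| \<le>o r" by (rule Sr)
    finally show "|subsets_upto \<kappa> (H \<beta>)| \<le>o r" .
  qed
  then have count: "|subsets_upto natLeq \<Gamma>| \<le>o r"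
    by (rule ordLeq_transitive[OF card_of_mono1[OF countable_sets]])
  have "|SIGMA m:(UNIV :: nat set). subsets_upto \<kappa> (V m)| \<le>o |S|"
  proof (rule card_of_Sigma_ordLeq_infinite)
    show "infinite S" by fact
    show "|UNIV :: nat set| \<le>o |S|"
      by (rule ordLeq_transitive[OF ordLess_imp_ordLeq[OF nat_small] kS])
    show "\<forall>m\<in>UNIV. |subsets_upto \<kappa> (V m)| \<le>o |S|" using below[OF V_sub V_small] by blast
  qed
  also have "|S| \<le>o |\<Gamma>|" unfolding \<Gamma>_def
    by (rule ordLeq_ordIso_trans[OF Sr ordIso_symmetric[OF Gam(2)]])
  finally obtain j where j: "inj_on j (SIGMA m:(UNIV :: nat set). subsets_upto \<kappa> (V m))"
    "j ` (SIGMA m:(UNIV :: nat set). subsets_upto \<kappa> (V m)) \<subseteq> \<Gamma>"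
    unfolding card_of_ordLeq[symmetric] by blast
  define c where "c = (\<lambda>y. range (\<lambda>m. j (m, y \<inter> V m)))"
  have inV: "(m, y \<inter> V m) \<in> (SIGMA m:(UNIV :: nat set). subsets_upto \<kappa> (V m))" if "y \<in> subsets_upto \<kappa> S" for y m
    using that ordLeq_transitive[OF card_of_mono1[of "y \<inter> V m" y]] unfolding subsets_upto_def by auto
  have "inj_on c (subsets_upto \<kappa> S)"
  proof (rule inj_onI)
    fix y y' assume y: "y \<in> subsets_upto \<kappa> S" "y' \<in> subsets_upto \<kappa> S" and eq: "c y = c y'"
    have eqm: "y \<inter> V m = y' \<inter> V m" for m
    proof -
      have "j (m, y \<inter> V m) \<in> c y" unfolding c_def by blast
      then have "j (m, y \<inter> V m) \<in> c y'" using eq by simp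
      then obtain m' where "j (m, y \<inter> V m) = j (m', y' \<inter> V m')" unfolding c_def by blast
      then have "(m, y \<inter> V m) = (m', y' \<inter> V m')" using inj_onD[OF j(1)] inV y by blast
      then show ?thesis by auto
    qed
    have "y \<subseteq> S" "y' \<subseteq> S" using y unfolding subsets_upto_def by blast+
    then show "y = y'" using eqm V_cover by blast
  qed
  moreover have "c y \<in> subsets_upto natLeq \<Gamma>" if "y \<in> subsets_upto \<kappa> S" for y
  proof -
    have "|c y| \<le>o natLeq" unfolding c_def
      by (rule ordLeq_ordIso_trans[OF card_of_image card_of_nat])
    moreover have "c y \<subseteq> \<Gamma>" unfolding c_def using j(2) inV[OF that] by blast
    ultimately show ?thesis unfolding subsets_upto_def by blast
  qed
  ultimately have "|subsets_upto \<kappa> S| \<le>o |subsets_upto natLeq \<Gamma>|" by (rule card_of_ordLeqI)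
  then show ?thesis using ordLeq_transitive[OF _ count] unfolding r_def by blast
qed

text \<open>
  Induction on the cardinality of \<open>S\<close>, with a case distinction on the least size of an unbounded
  subset \<open>y\<close> of \<open>S\<close> in the cardinal well-order \<open>|S|\<close>: more than \<open>\<kappa>\<close>, countable, or uncountable and at
  most \<open>\<kappa>\<close>.
\<close>

lemma card_of_subsets_upto_less:
  fixes S :: "'l set"
  assumes lb: level_bounding
  shows "ctwo ^c \<kappa> \<le>o |S| \<Longrightarrow> |S| <o \<Lambda> \<Longrightarrow> |subsets_upto \<kappa> S| \<le>o cardSuc |S|"
proof (induction "|S|" arbitrary: S rule: wf_induct_rule[OF wf_ordLess])
  case (1 S)
  note S = 1(2,3)
  have IH: "|subsets_upto \<kappa> S'| \<le>o cardSuc |S'|" if "|S'| <o |S|" "ctwo ^c \<kappa> \<le>o |S'|" for S' :: "'l set"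
    by (rule 1(1)[OF that(1,2) ordLess_transitive[OF that(1) S(2)]])
  have two: "Cinfinite (ctwo ^c \<kappa>)" by (rule Cinfinite_ctwo_cexp[OF kappa_inf])
  have kS: "\<kappa> \<le>o |S|"
    using ordLeq_transitive[OF ordLess_imp_ordLeq[OF less_ctwo_cexp[OF kappa_inf]] S(1)] .
  have "infinite S"
    using cinfinite_mono[OF kS] kappa_inf unfolding cinfinite_def Field_card_of by blast
  then have Sinf: "Cinfinite |S|" by (rule Cinfinite_card_of)
  have Ssuc: "|S| \<le>o cardSuc |S|" by (rule cardSuc_ordLeq[OF card_of_Card_order])
  have below: "|subsets_upto \<kappa> S'| \<le>o |S|" if S': "|S'| <o |S|" for S' :: "'l set"
  proof (cases "ctwo ^c \<kappa> \<le>o |S'|")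
    case True
    show ?thesis by (rule ordLeq_transitive[OF IH[OF S' True] cardSuc_le_of_less[OF S']])
  next
    case False
    then have "|S'| <o ctwo ^c \<kappa>"
      using Card_order_not_ordLeq[OF _ card_of_Card_order] two by blast
    then have "|subsets_upto \<kappa> S'| \<le>o ctwo ^c \<kappa>"
      using card_of_subsets_upto_cexp[OF kappa_inf ordLess_imp_ordLeq] by blast
    then show ?thesis by (rule ordLeq_transitive[OF _ S(1)])
  qed
  show ?case
  proof (cases "|S| \<le>o ctwo ^c \<kappa>")
    case True
    show ?thesis
      by (rule ordLeq_transitive[OF card_of_subsets_upto_cexp[OF kappa_inf True] ordLeq_transitive[OF S(1) Ssuc]])
  next
    case False
    have wo: "wo_rel |S|" unfolding wo_rel_def by (rule card_of_Well_order)
    have total: "(s, t) \<in> |S| \<or> (t, s) \<in> |S|" if "s \<in> S" "t \<in> S" for s t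
      using wo_rel.TOTALS[OF wo] that unfolding Field_card_of by blast
    have trans: "(s, u) \<in> |S|" if "(s, t) \<in> |S|" "(t, u) \<in> |S|" for s t u
      using wo_rel.TRANS[OF wo] that unfolding trans_def by blast
    have under_small: "|under |S| s| <o |S|" if "s \<in> S" for s
      using card_of_under_less[OF Sinf, of s] that unfolding Field_card_of by blast
    have under_sub: "under |S| s \<subseteq> S" for s
      using under_Field[of "|S|" s] unfolding Field_card_of by blast
    define unbounded where "unbounded = (\<lambda>y. y \<subseteq> S \<and> (\<forall>s\<in>S. \<exists>t\<in>y. (s, t) \<in> |S| ))"
    have bounded: "\<exists>s\<in>S. \<forall>t\<in>y. (t, s) \<in> |S|" if "y \<subseteq> S" "\<not> unbounded y" for y
      using that total unfolding unbounded_def by blast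
    show ?thesis
    proof (cases "\<exists>y. unbounded y \<and> |y| \<le>o \<kappa>")
      case no_short: False
      have "subsets_upto \<kappa> S \<subseteq> (\<Union>s\<in>S. subsets_upto \<kappa> (under |S| s))"
      proof
        fix y assume y: "y \<in> subsets_upto \<kappa> S"
        then have "y \<subseteq> S" "\<not> unbounded y" using no_short unfolding subsets_upto_def by blast+
        then obtain s where s: "s \<in> S" "\<forall>t\<in>y. (t, s) \<in> |S|" using bounded by blast
        then have "y \<subseteq> under |S| s" unfolding under_def by blast
        then show "y \<in> (\<Union>s\<in>S. subsets_upto \<kappa> (under |S| s))"
          using y s(1) unfolding subsets_upto_def by blast
      qed
      moreover have "|\<Union>s\<in>S. subsets_upto \<kappa> (under |S| s)| \<le>o |S|"
        by (intro UNION_Cinfinite_bound[OF ordLeq_refl[OF card_of_Card_order] _ Sinf] ballI)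
          (rule below[OF under_small])
      ultimately have "|subsets_upto \<kappa> S| \<le>o |S|"
        by (rule ordLeq_transitive[OF card_of_mono1])
      then show ?thesis by (rule ordLeq_transitive[OF _ Ssuc])
    next
      case True
      define R where "R = card_of ` {y. unbounded y}"
      have "R \<noteq> {}" using True unfolding R_def by blast
      moreover have "\<forall>r\<in>R. Card_order r" unfolding R_def using card_of_Card_order by blast
      ultimately obtain \<tau> where "\<tau> \<in> R" "\<forall>r'\<in>R. \<tau> \<le>o r'" using exists_minim_Card_order by blast
      then obtain y where y: "unbounded y" "\<And>y'. unbounded y' \<Longrightarrow> |y| \<le>o |y'|" unfolding R_def by blast
      obtain y1 where y1: "unbounded y1" "|y1| \<le>o \<kappa>" using True by blast
      have y_kappa: "|y| \<le>o \<kappa>" by (rule ordLeq_transitive[OF y(2)[OF y1(1)] y1(2)])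
      have yS: "y \<subseteq> S" using y(1) unfolding unbounded_def by blast
      have y_cof: "\<exists>t\<in>y. (s, t) \<in> |S|" if "s \<in> S" for s using y(1) that unfolding unbounded_def by blast
      have short: "\<exists>s\<in>S. \<forall>t\<in>z. (t, s) \<in> |S|" if "z \<subseteq> S" "|z| <o |y|" for z
      proof (rule bounded[OF that(1)])
        show "\<not> unbounded z" using y(2)[of z] not_ordLess_ordLeq[OF that(2)] by blast
      qed
      show ?thesis
      proof (cases "|y| \<le>o natLeq")
        case y_countable: True
        have "S \<noteq> {}" using \<open>infinite S\<close> by auto
        then have "y \<noteq> {}" using y_cof by blast
        moreover have "|y| \<le>o |UNIV :: nat set|"
          by (rule ordLeq_ordIso_trans[OF y_countable ordIso_symmetric[OF card_of_nat]])
        ultimately obtain g :: "nat \<Rightarrow> 'l" where g: "range g = y"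
          using card_of_ordLeq2[of y "UNIV :: nat set"] by blast
        show ?thesis
        proof (rule card_of_subsets_upto_countable_cofinality[OF lb S])
          show "(\<Union>n. under |S| (g n)) = S"
          proof
            show "(\<Union>n. under |S| (g n)) \<subseteq> S" using under_sub by blast
            show "S \<subseteq> (\<Union>n. under |S| (g n))"
            proof
              fix s assume "s \<in> S"
              then obtain t where "t \<in> y" "(s, t) \<in> |S|" using y_cof by blast
              then show "s \<in> (\<Union>n. under |S| (g n))" using g unfolding under_def by blast
            qed
          qed
          show "|under |S| (g n)| <o |S|" for n using under_small g yS by blast
          show "|subsets_upto \<kappa> S'| \<le>o |S|" if "|S'| <o |S|" for S' :: "'l set" by (rule below[OF that])
        qed
      next
        case y_uncountable: False
        define \<tau> where "\<tau> = |y|"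
        have nat_tau: "natLeq <o \<tau>"
          unfolding \<tau>_def
          by (rule Card_order_not_ordLeq[OF card_of_Card_order natLeq_Card_order y_uncountable])
        have F: "Field \<tau> = y" unfolding \<tau>_def by (rule Field_card_of)
        have tauC: "Cinfinite \<tau>"
          using cinfinite_mono[OF ordLess_imp_ordLeq[OF nat_tau] natLeq_cinfinite] card_of_Card_order
          unfolding \<tau>_def by blast
        have "\<exists>t. t \<in> S \<and> (\<forall>s\<in>underS \<tau> z. (s, t) \<in> |S| )" if z: "z \<in> y" for z
        proof -
          have "|underS \<tau> z| <o |y|" using card_of_underS[of \<tau> z] tauC z F unfolding \<tau>_def by blast
          moreover have "underS \<tau> z \<subseteq> S" using underS_Field[of _ \<tau> z] F yS by blast
          ultimately show ?thesis using short by blast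
        qed
        then obtain t where t: "\<And>z. z \<in> y \<Longrightarrow> t z \<in> S" "\<And>z s. z \<in> y \<Longrightarrow> s \<in> underS \<tau> z \<Longrightarrow> (s, t z) \<in> |S|"
          by metis
        have tau_reg: "regularCard \<tau>"
          unfolding regularCard_def
        proof (intro allI impI)
          fix K assume K: "K \<subseteq> Field \<tau> \<and> cofinal K \<tau>"
          then have Ky: "K \<subseteq> y" using F by blast
          have "\<not> |K| <o |y|"
          proof
            assume less: "|K| <o |y|"
            have "|t ` K| <o |y|" by (rule ordLeq_ordLess_trans[OF card_of_image less])
            moreover have "t ` K \<subseteq> S" using t(1) Ky by blast
            ultimately obtain s where s: "s \<in> S" "\<forall>x\<in>t ` K. (x, s) \<in> |S|" using short by blast
            \<comment> \<open>\<open>s\<close> bounds \<open>t ` K\<close>, but since \<open>K\<close> is cofinal in \<open>\<tau>\<close>, some value of \<open>t\<close> on \<open>K\<close> exceeds \<open>s'\<close>.\<close>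
            obtain s' where s': "s' \<in> S" "s \<noteq> s'" "(s, s') \<in> |S|"
              using infinite_Card_order_limit[of "|S|" s] Sinf s(1) under_sub
              unfolding cinfinite_def Field_card_of under_def by blast
            obtain u where u: "u \<in> y" "(s', u) \<in> |S|" using y_cof[OF s'(1)] by blast
            obtain k where k: "k \<in> K" "u \<noteq> k" "(u, k) \<in> \<tau>" using K u(1) F unfolding cofinal_def by blast
            then have "(u, t k) \<in> |S|" using t(2)[of k u] Ky unfolding underS_def by blast
            then have "(s', s) \<in> |S|" using trans[OF u(2)] trans s(2) k(1) by blast
            then show False using s' wo_rel.ANTISYM[OF wo] unfolding antisym_def by blast
          qed
          then have "|y| \<le>o |K|"
            using Card_order_not_ordLeq[OF card_of_Card_order card_of_Card_order, of y K] by blast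
          then show "|K| =o \<tau>" unfolding \<tau>_def using card_of_mono1[OF Ky] ordIso_iff_ordLeq by blast
        qed
        have two_S: "ctwo ^c \<kappa> <o |S|"
          using Card_order_not_ordLeq[OF card_of_Card_order _ False] two by blast
        \<comment> \<open>Adding \<open>P\<close> to all initial segments makes them large enough for the induction hypothesis.\<close>
        obtain P where P: "P \<subseteq> S" "ctwo ^c \<kappa> =o |P|"
          using internalize_card_of_ordLeq2[of "Func (Field \<kappa>) (Field ctwo)" S] S(1) unfolding cexp_def by blast
        have P_small: "|P| <o |S|" by (rule ordIso_ordLess_trans[OF ordIso_symmetric[OF P(2)] two_S])
        show ?thesis
        proof (rule card_of_subsets_upto_uncountable_cofinality[OF kappa_inf tauC tau_reg nat_tau])
          show "\<tau> \<le>o \<kappa>" unfolding \<tau>_def by (rule y_kappa)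
          show "(\<Union>i\<in>Field \<tau>. under |S| i \<union> P) = S"
          proof
            show "(\<Union>i\<in>Field \<tau>. under |S| i \<union> P) \<subseteq> S" using under_sub P(1) by blast
            show "S \<subseteq> (\<Union>i\<in>Field \<tau>. under |S| i \<union> P)"
            proof
              fix s assume "s \<in> S"
              then obtain t where "t \<in> y" "(s, t) \<in> |S|" using y_cof by blast
              then show "s \<in> (\<Union>i\<in>Field \<tau>. under |S| i \<union> P)" using F unfolding under_def by blast
            qed
          qed
          show "ctwo ^c \<kappa> \<le>o |under |S| i \<union> P|" if "i \<in> Field \<tau>" for i
            by (rule ordIso_ordLeq_trans[OF P(2) card_of_mono1]) blast
          show "|\<Union>i\<in>underS \<tau> \<zeta>. under |S| i \<union> P| <o |S|" if z: "\<zeta> \<in> Field \<tau>" for \<zeta>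
          proof (rule ordLeq_ordLess_trans[OF card_of_mono1])
            show "(\<Union>i\<in>underS \<tau> \<zeta>. under |S| i \<union> P) \<subseteq> under |S| (t \<zeta>) \<union> P"
              using t(2)[of \<zeta>] z F trans unfolding under_def by blast
            show "|under |S| (t \<zeta>) \<union> P| <o |S|"
              using Un_Cinfinite_bound_strict[OF under_small P_small Sinf] t(1) z F by blast
          qed
          show "|subsets_upto \<kappa> S'| \<le>o cardSuc |S'|" if "ctwo ^c \<kappa> \<le>o |S'|" "|S'| <o |S|" for S' :: "'l set"
            by (rule IH[OF that(2,1)])
        qed
      qed
    qed
  qed
qed

section \<open>Coding small relations, and the refutation\<close>

lemma kappa_less_Lam: "\<kappa> <o \<Lambda>"
  by (rule ordLess_ordLeq_trans[OF less_ctwo_cexp[OF kappa_inf] Lam(3)])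

lemma card_of_subsets_upto_le_Lam:
  fixes S :: "'b set"
  assumes lb: level_bounding and S: "|S| <o \<Lambda>"
  shows "|subsets_upto \<kappa> S| \<le>o \<Lambda>"
proof -
  have "|S| \<le>o |Field \<Lambda>|"
    by (rule ordLeq_ordIso_trans[OF ordLess_imp_ordLeq[OF S] ordIso_symmetric[OF card_of_Field_ordIso[OF Lam(1)]]])
  then obtain S' where S': "S' \<subseteq> Field \<Lambda>" "|S| =o |S'|"
    using internalize_card_of_ordLeq2[of S "Field \<Lambda>"] by blast
  have S'_less: "|S'| <o \<Lambda>" by (rule ordIso_ordLess_trans[OF ordIso_symmetric[OF S'(2)] S])
  have "|subsets_upto \<kappa> S'| \<le>o \<Lambda>"
  proof (cases "ctwo ^c \<kappa> \<le>o |S'|")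
    case True
    show ?thesis
      by (rule ordLeq_transitive[OF card_of_subsets_upto_less[OF lb True S'_less]
            cardSuc_least[OF card_of_Card_order Lam(1) S'_less]])
  next
    case False
    have "|S'| \<le>o ctwo ^c \<kappa>"
      by (rule ordLess_imp_ordLeq[OF Card_order_not_ordLeq[OF Card_order_cexp card_of_Card_order False]])
    then show ?thesis
      by (rule ordLeq_transitive[OF card_of_subsets_upto_cexp[OF kappa_inf] Lam(3)])
  qed
  then show ?thesis
    by (rule ordLeq_transitive[OF card_of_subsets_upto_mono[OF ordIso_imp_ordLeq[OF S'(2)]]])
qed

lemma card_of_Times_less_Lam:
  assumes "|X| \<le>o \<kappa>" "|Y| <o \<Lambda>"
  shows "|X \<times> Y| <o \<Lambda>"
proof (cases "|Y| \<le>o \<kappa>")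
  case True
  then have "|X \<times> Y| \<le>o \<kappa>"
    using card_of_Times_ordLeq_infinite_Field[of \<kappa> X Y] kappa_inf assms(1) unfolding cinfinite_def by blast
  then show ?thesis by (rule ordLeq_ordLess_trans[OF _ kappa_less_Lam])
next
  case False
  have Y: "\<kappa> \<le>o |Y|"
    by (rule ordLess_imp_ordLeq[OF Card_order_not_ordLeq[OF card_of_Card_order kappa(1) False]])
  have "\<not> finite (Field |Y| )"
    using cinfinite_mono[OF Y] kappa_inf unfolding cinfinite_def by blast
  then have "|X \<times> Y| \<le>o |Y|"
    using card_of_Times_ordLeq_infinite_Field[of "|Y|" X Y] ordLeq_transitive[OF assms(1) Y]
      ordLeq_refl[OF card_of_Card_order] card_of_Card_order by blast
  then show ?thesis by (rule ordLeq_ordLess_trans[OF _ assms(2)])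
qed

lemma subset_of_size_kappa:
  assumes "\<kappa> \<le>o |\<Gamma>|"
  obtains X where "X \<subseteq> \<Gamma>" "|X| =o \<kappa>"
proof -
  have "|Field \<kappa>| \<le>o |\<Gamma>|"
    by (rule ordIso_ordLeq_trans[OF card_of_Field_ordIso[OF kappa(1)] assms])
  then obtain X where "X \<subseteq> \<Gamma>" "|Field \<kappa>| =o |X|"
    using internalize_card_of_ordLeq2[of "Field \<kappa>" \<Gamma>] by blast
  then show ?thesis
    using that ordIso_transitive[OF ordIso_symmetric card_of_Field_ordIso[OF kappa(1)]] by blast
qed

text \<open>
  If \<open>\<lambda>\<close> has cofinality below \<open>\<kappa>\<close>, take an unbounded set \<open>Z\<close> of that size. Otherwise each \<open>e \<gamma>\<close> is bounded in
  \<open>\<lambda>\<close>, and one initial segment is enough: if the cofinality is \<open>\<kappa>\<close>, then by the pigeonhole principle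
  it contains \<open>e \<gamma>\<close> for more than \<open>\<kappa>\<close> many of the \<open>\<kappa>\<^sup>+\<close> many \<open>\<gamma>\<close>; if the cofinality is larger, any
  \<open>\<kappa>\<close> many sets are jointly bounded.
\<close>

lemma many_sets_in_few_segments:
  fixes e :: "'r \<Rightarrow> 'l set"
  assumes Gam: "cardSuc \<kappa> \<le>o |\<Gamma>|" and e: "\<And>\<gamma>. \<gamma> \<in> \<Gamma> \<Longrightarrow> e \<gamma> \<in> PK"
  obtains X Z where "X \<subseteq> \<Gamma>" "|X| =o \<kappa>" "Z \<subseteq> Field \<Lambda>" "|Z| <o \<kappa>" "Z \<noteq> {}"
    "\<And>\<gamma>. \<gamma> \<in> X \<Longrightarrow> e \<gamma> \<subseteq> (\<Union>z\<in>Z. under \<Lambda> z)"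
proof -
  have wo: "wo_rel \<Lambda>" using Lam(1) card_order_on_well_order_on unfolding wo_rel_def by blast
  have total: "(s, t) \<in> \<Lambda> \<or> (t, s) \<in> \<Lambda>" if "s \<in> Field \<Lambda>" "t \<in> Field \<Lambda>" for s t
    using wo_rel.TOTALS[OF wo] that by blast
  have trans: "(s, u) \<in> \<Lambda>" if "(s, t) \<in> \<Lambda>" "(t, u) \<in> \<Lambda>" for s t u
    using wo_rel.TRANS[OF wo] that unfolding trans_def by blast
  have kGam: "\<kappa> \<le>o |\<Gamma>|" by (rule ordLeq_transitive[OF cardSuc_ordLeq[OF kappa(1)] Gam])
  define unbounded where "unbounded = (\<lambda>Z. Z \<subseteq> Field \<Lambda> \<and> (\<forall>s\<in>Field \<Lambda>. \<exists>z\<in>Z. (s, z) \<in> \<Lambda>))"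
  have bounded: "\<exists>s\<in>Field \<Lambda>. \<forall>z\<in>Z. (z, s) \<in> \<Lambda>" if Z: "Z \<subseteq> Field \<Lambda>" "\<not> unbounded Z" for Z
  proof -
    obtain s where s: "s \<in> Field \<Lambda>" "\<forall>z\<in>Z. (s, z) \<notin> \<Lambda>" using Z unfolding unbounded_def by blast
    have "(z, s) \<in> \<Lambda>" if "z \<in> Z" for z using total[OF s(1), of z] s(2) that Z(1) by blast
    then show ?thesis using s(1) by blast
  qed
  have F_ne: "Field \<Lambda> \<noteq> {}" by (rule Cnotzero_imp_not_empty[OF Cinfinite_Cnotzero[OF Lam_inf]])
  have eF: "e \<gamma> \<subseteq> Field \<Lambda>" if "\<gamma> \<in> \<Gamma>" for \<gamma> using e[OF that] unfolding Pkl_def by blast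
  show ?thesis
  proof (cases "\<exists>Z. unbounded Z \<and> |Z| <o \<kappa>")
    case True
    then obtain Z where Z: "unbounded Z" "|Z| <o \<kappa>" by blast
    obtain X where X: "X \<subseteq> \<Gamma>" "|X| =o \<kappa>" by (rule subset_of_size_kappa[OF kGam])
    have "e \<gamma> \<subseteq> (\<Union>z\<in>Z. under \<Lambda> z)" if "\<gamma> \<in> X" for \<gamma>
    proof -
      have "e \<gamma> \<subseteq> Field \<Lambda>" using eF X(1) that by blast
      then show ?thesis using Z(1) unfolding unbounded_def under_def by blast
    qed
    moreover have "Z \<subseteq> Field \<Lambda>" "Z \<noteq> {}" using Z(1) F_ne unfolding unbounded_def by blast+
    ultimately show ?thesis using that X Z(2) by blast
  next
    case no_short: False
    have "\<exists>z. z \<in> Field \<Lambda> \<and> (\<forall>s\<in>e \<gamma>. (s, z) \<in> \<Lambda>)" if g: "\<gamma> \<in> \<Gamma>" for \<gamma>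
    proof -
      have "|e \<gamma>| <o \<kappa>" using e[OF g] unfolding Pkl_def by blast
      then have "\<not> unbounded (e \<gamma>)" using no_short by blast
      then show ?thesis using bounded[OF eF[OF g]] by blast
    qed
    then obtain u where u: "\<And>\<gamma>. \<gamma> \<in> \<Gamma> \<Longrightarrow> u \<gamma> \<in> Field \<Lambda>" "\<And>\<gamma> s. \<gamma> \<in> \<Gamma> \<Longrightarrow> s \<in> e \<gamma> \<Longrightarrow> (s, u \<gamma>) \<in> \<Lambda>"
      by metis
    have "\<exists>X z. X \<subseteq> \<Gamma> \<and> |X| =o \<kappa> \<and> z \<in> Field \<Lambda> \<and> (\<forall>\<gamma>\<in>X. (u \<gamma>, z) \<in> \<Lambda>)"
    proof (cases "\<exists>Z. unbounded Z \<and> |Z| \<le>o \<kappa>")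
      case True
      then obtain Z where Z: "unbounded Z" "|Z| \<le>o \<kappa>" by blast
      define \<Delta> where "\<Delta> = (\<lambda>z. {\<gamma> \<in> \<Gamma>. (u \<gamma>, z) \<in> \<Lambda>})"
      have "\<exists>z\<in>Z. \<not> |\<Delta> z| \<le>o \<kappa>"
      proof (rule ccontr)
        assume "\<not> ?thesis"
        then have "\<forall>z\<in>Z. |\<Delta> z| \<le>o \<kappa>" by blast
        then have union_le: "|\<Union>z\<in>Z. \<Delta> z| \<le>o \<kappa>" by (rule UNION_Cinfinite_bound[OF Z(2) _ kappa_inf])
        have "\<Gamma> \<subseteq> (\<Union>z\<in>Z. \<Delta> z)" using Z(1) u(1) unfolding unbounded_def \<Delta>_def by blast
        then have "|\<Gamma>| \<le>o \<kappa>" by (rule ordLeq_transitive[OF card_of_mono1 union_le])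
        then have "cardSuc \<kappa> \<le>o \<kappa>" by (rule ordLeq_transitive[OF Gam])
        then show False using not_ordLess_ordLeq[OF cardSuc_greater[OF kappa(1)]] by blast
      qed
      then obtain z where z: "z \<in> Z" "\<not> |\<Delta> z| \<le>o \<kappa>" by blast
      have "\<kappa> \<le>o |\<Delta> z|"
        by (rule ordLess_imp_ordLeq[OF Card_order_not_ordLeq[OF card_of_Card_order kappa(1) z(2)]])
      then obtain X where "X \<subseteq> \<Delta> z" "|X| =o \<kappa>" by (rule subset_of_size_kappa)
      then show ?thesis using z(1) Z(1) unfolding unbounded_def \<Delta>_def by blast
    next
      case False
      obtain X where X: "X \<subseteq> \<Gamma>" "|X| =o \<kappa>" by (rule subset_of_size_kappa[OF kGam])
      have "|u ` X| \<le>o \<kappa>" by (rule ordLeq_ordIso_trans[OF card_of_image X(2)])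
      then have "\<not> unbounded (u ` X)" using False by blast
      moreover have "u ` X \<subseteq> Field \<Lambda>" using u(1) X(1) by blast
      ultimately obtain z where "z \<in> Field \<Lambda>" "\<forall>x\<in>u ` X. (x, z) \<in> \<Lambda>" using bounded by blast
      then show ?thesis using X by blast
    qed
    then obtain X z where X: "X \<subseteq> \<Gamma>" "|X| =o \<kappa>" and z: "z \<in> Field \<Lambda>" "\<forall>\<gamma>\<in>X. (u \<gamma>, z) \<in> \<Lambda>"
      by blast
    have "e \<gamma> \<subseteq> (\<Union>z\<in>{z}. under \<Lambda> z)" if g: "\<gamma> \<in> X" for \<gamma>
    proof
      fix s assume "s \<in> e \<gamma>"
      then have "(s, u \<gamma>) \<in> \<Lambda>" using u(2) X(1) g by blast
      then have "(s, z) \<in> \<Lambda>" using trans z(2) g by blast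
      then show "s \<in> (\<Union>z\<in>{z}. under \<Lambda> z)" unfolding under_def by blast
    qed
    moreover have "|{z}| <o \<kappa>" by (rule finite_less_Cinfinite[OF kappa_inf]) simp
    ultimately show ?thesis using that[OF X, of "{z}"] z(1) by blast
  qed
qed

text \<open>
  A code stands for a pair of a small set \<open>X \<subseteq> \<kappa>\<^sup>+\<close> and a small relation between \<open>X\<close> and a proper
  initial segment of \<open>\<lambda>\<close>. There are \<open>2\<^sup>\<kappa> \<le> \<lambda>\<close> sets \<open>X\<close>, and for each \<open>X\<close> and each segment at most \<open>\<lambda>\<close>
  relations, by the bound on powers.
\<close>

lemma ex_coding:
  assumes lb: level_bounding
  obtains cd :: "'l \<Rightarrow> 'k set set \<times> ('k set \<times> 'l) set" where
    "\<And>k. k \<in> Field \<Lambda> \<Longrightarrow> fst (cd k) \<subseteq> Field (cardSuc \<kappa>)"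
    "\<And>k. k \<in> Field \<Lambda> \<Longrightarrow> snd (cd k) \<subseteq> fst (cd k) \<times> Field \<Lambda>"
    "\<And>X R z. X \<subseteq> Field (cardSuc \<kappa>) \<Longrightarrow> |X| \<le>o \<kappa> \<Longrightarrow> z \<in> Field \<Lambda> \<Longrightarrow> R \<subseteq> X \<times> under \<Lambda> z \<Longrightarrow>
       |R| \<le>o \<kappa> \<Longrightarrow> \<exists>k\<in>Field \<Lambda>. cd k = (X, R)"
proof -
  define r where "r = cardSuc \<kappa>"
  define \<Q> where "\<Q> = (\<Union>X\<in>subsets_upto \<kappa> (Field r). \<Union>z\<in>Field \<Lambda>. Pair X ` subsets_upto \<kappa> (X \<times> under \<Lambda> z))"
  have FL: "|Field \<Lambda>| =o \<Lambda>" by (rule card_of_Field_ordIso[OF Lam(1)])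
  have "r \<le>o ctwo ^c \<kappa>"
    unfolding r_def by (rule cardSuc_least[OF kappa(1) Card_order_cexp less_ctwo_cexp[OF kappa_inf]])
  then have "|Field r| \<le>o ctwo ^c \<kappa>"
    using ordIso_ordLeq_trans[OF card_of_Field_ordIso] cardSuc_Card_order[OF kappa(1)] unfolding r_def by blast
  then have "|subsets_upto \<kappa> (Field r)| \<le>o ctwo ^c \<kappa>" by (rule card_of_subsets_upto_cexp[OF kappa_inf])
  then have index: "|subsets_upto \<kappa> (Field r)| \<le>o \<Lambda>" by (rule ordLeq_transitive[OF _ Lam(3)])
  have "|\<Q>| \<le>o \<Lambda>"
    unfolding \<Q>_def
  proof (intro UNION_Cinfinite_bound[OF index _ Lam_inf] ballI UNION_Cinfinite_bound[OF ordIso_imp_ordLeq[OF FL] _ Lam_inf])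
    fix X z assume X: "X \<in> subsets_upto \<kappa> (Field r)" and z: "z \<in> Field \<Lambda>"
    have "|X| \<le>o \<kappa>" using X unfolding subsets_upto_def by blast
    then have "|X \<times> under \<Lambda> z| <o \<Lambda>"
      by (rule card_of_Times_less_Lam[OF _ card_of_under_less[OF Lam_inf z]])
    then have "|subsets_upto \<kappa> (X \<times> under \<Lambda> z)| \<le>o \<Lambda>" by (rule card_of_subsets_upto_le_Lam[OF lb])
    then show "|Pair X ` subsets_upto \<kappa> (X \<times> under \<Lambda> z)| \<le>o \<Lambda>"
      by (rule ordLeq_transitive[OF card_of_image])
  qed
  then have Q_le: "|\<Q>| \<le>o |Field \<Lambda>|" by (rule ordLeq_ordIso_trans[OF _ ordIso_symmetric[OF FL]])
  have inQ: "(X, R) \<in> \<Q>" if "X \<subseteq> Field r" "|X| \<le>o \<kappa>" "z \<in> Field \<Lambda>" "R \<subseteq> X \<times> under \<Lambda> z" "|R| \<le>o \<kappa>" for X R z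
    using that unfolding \<Q>_def subsets_upto_def by blast
  have F_ne: "Field \<Lambda> \<noteq> {}" by (rule Cnotzero_imp_not_empty[OF Cinfinite_Cnotzero[OF Lam_inf]])
  have "|{} :: 'k set set| \<le>o \<kappa>" "|{} :: ('k set \<times> 'l) set| \<le>o \<kappa>"
    by (simp_all add: ordLess_imp_ordLeq finite_less_Cinfinite[OF kappa_inf])
  then have "\<Q> \<noteq> {}" using F_ne inQ[of "{}" _ "{}"] by blast
  then obtain cd where cd: "cd ` Field \<Lambda> = \<Q>" using Q_le card_of_ordLeq2[of \<Q> "Field \<Lambda>"] by blast
  show ?thesis
  proof (rule that[of cd, folded r_def])
    fix k assume "k \<in> Field \<Lambda>"
    then have "cd k \<in> \<Q>" using cd by blast
    then show "fst (cd k) \<subseteq> Field r" "snd (cd k) \<subseteq> fst (cd k) \<times> Field \<Lambda>"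
      using under_Field[of \<Lambda>] unfolding \<Q>_def subsets_upto_def by fastforce+
  next
    fix X R z assume "X \<subseteq> Field r" "|X| \<le>o \<kappa>" "z \<in> Field \<Lambda>" "R \<subseteq> X \<times> under \<Lambda> z" "|R| \<le>o \<kappa>"
    then have "(X, R) \<in> cd ` Field \<Lambda>" unfolding cd by (rule inQ)
    then show "\<exists>k\<in>Field \<Lambda>. cd k = (X, R)" by (auto simp: eq_commute)
  qed
qed

text \<open>
  The relation \<open>grows a a'\<close> is one step in the construction of a sequence: for each code \<open>k \<in> a\<close> of a pair
  \<open>(X, R)\<close> with \<open>|X| = \<kappa>\<close>, the next set contains a new element of \<open>X\<close>, and it contains the section \<open>R `` {\<gamma>}\<close>, if
  its size is less than \<open>\<kappa>\<close>, for each \<open>\<gamma> \<in> X\<close> in \<open>a\<close>. When fewer than \<open>\<kappa>\<close> codes with the same \<open>X\<close> together describe \<open>e\<close> on \<open>X\<close>, it is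
  enough that one of them has entered by stage \<open>m\<close> for new elements of \<open>X\<close> to appear after \<open>m\<close>, and that each
  of them enters eventually for \<open>e \<gamma>\<close> to be included; the codes need not enter at a common stage.
\<close>

lemma not_level_bounding: "\<not> level_bounding"
proof
  assume lb: level_bounding
  define r where "r = cardSuc \<kappa>"
  have rC: "Cinfinite r" unfolding r_def by (rule Cinfinite_cardSuc[OF kappa_inf])
  have rreg: "regularCard r" unfolding r_def by (rule regularCard_cardSuc[OF kappa_inf])
  have kr: "\<kappa> \<le>o r" unfolding r_def by (rule cardSuc_ordLeq[OF kappa(1)])
  have rL: "r \<le>o \<Lambda>" unfolding r_def by (rule cardSuc_least[OF kappa(1) Lam(1) kappa_less_Lam])
  obtain \<iota> where iota: "inj_on \<iota> (Field r)" "\<iota> ` Field r \<subseteq> Field \<Lambda>"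
    using card_of_mono2[OF rL] unfolding card_of_ordLeq[symmetric] by blast
  obtain cd :: "'l \<Rightarrow> 'k set set \<times> ('k set \<times> 'l) set" where
    cd1: "\<And>k. k \<in> Field \<Lambda> \<Longrightarrow> fst (cd k) \<subseteq> Field r" and
    cd2: "\<And>k. k \<in> Field \<Lambda> \<Longrightarrow> snd (cd k) \<subseteq> fst (cd k) \<times> Field \<Lambda>" and
    cd3: "\<And>X R z. X \<subseteq> Field r \<Longrightarrow> |X| \<le>o \<kappa> \<Longrightarrow> z \<in> Field \<Lambda> \<Longrightarrow> R \<subseteq> X \<times> under \<Lambda> z \<Longrightarrow>
       |R| \<le>o \<kappa> \<Longrightarrow> \<exists>k\<in>Field \<Lambda>. cd k = (X, R)"
    unfolding r_def using ex_coding[OF lb] by metis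
  define grows where "grows = (\<lambda>a a'. a \<subseteq> a' \<and> (\<forall>k\<in>a.
      (\<kappa> \<le>o |fst (cd k)| \<longrightarrow> (\<exists>\<gamma>\<in>fst (cd k). \<iota> \<gamma> \<in> a' - a)) \<and>
      (\<forall>\<gamma>\<in>fst (cd k). \<iota> \<gamma> \<in> a \<longrightarrow> |snd (cd k) `` {\<gamma>}| <o \<kappa> \<longrightarrow> snd (cd k) `` {\<gamma>} \<subseteq> a')))"
  have C_cof: "\<exists>b\<in>C. a \<subseteq> b" if "a \<in> PK" for a
    using C_club(1) that unfolding club_def by metis
  have C_sub: "C \<subseteq> PK" using C_club(1) unfolding club_def by metis
  have step: "\<exists>a'\<in>C. grows a a'" if a: "a \<in> PK" for a
  proof -
    have a_small: "|a| <o \<kappa>" and aF: "a \<subseteq> Field \<Lambda>" using a unfolding Pkl_def by blast+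
    define new where "new = (\<lambda>k. SOME \<gamma>. \<gamma> \<in> fst (cd k) \<and> \<iota> \<gamma> \<notin> a)"
    define N where "N = (\<lambda>k. {\<iota> (new k)} \<inter> Field \<Lambda>)"
    \<comment> \<open>Codes may have sections of size \<open>\<kappa>\<close>, which do not fit into an element of \<open>P\<^sub>\<kappa>(\<lambda>)\<close>.\<close>
    define E where "E = (\<lambda>k x. if |snd (cd k) `` {inv_into (Field r) \<iota> x}| <o \<kappa>
      then snd (cd k) `` {inv_into (Field r) \<iota> x} else {})"
    have new: "new k \<in> fst (cd k) \<and> \<iota> (new k) \<notin> a" if k: "k \<in> a" "\<kappa> \<le>o |fst (cd k)|" for k
    proof -
      have "\<not> \<iota> ` fst (cd k) \<subseteq> a"
      proof
        assume "\<iota> ` fst (cd k) \<subseteq> a"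
        moreover have "inj_on \<iota> (fst (cd k))" using iota(1) cd1 k(1) aF inj_on_subset by blast
        ultimately have "|fst (cd k)| \<le>o |a|" by (intro card_of_ordLeqI) auto
        then have "|fst (cd k)| <o \<kappa>" by (rule ordLeq_ordLess_trans[OF _ a_small])
        then show False using not_ordLess_ordLeq k(2) by blast
      qed
      then have "\<exists>\<gamma>. \<gamma> \<in> fst (cd k) \<and> \<iota> \<gamma> \<notin> a" by blast
      then show ?thesis unfolding new_def by (rule someI_ex)
    qed
    have "N k \<in> PK" for k unfolding N_def by (rule finite_in_PK) auto
    then have 1: "(\<Union>k\<in>a. N k) \<in> PK" by (intro small_Union_in_PK[OF a_small])
    have "E k x \<in> PK" if k: "k \<in> a" for k x
    proof -
      have "snd (cd k) `` {inv_into (Field r) \<iota> x} \<subseteq> Field \<Lambda>" using cd2 k aF by blast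
      moreover have "{} \<in> PK" by (rule finite_in_PK) auto
      ultimately show ?thesis unfolding E_def Pkl_def by simp
    qed
    then have 2: "(\<Union>k\<in>a. \<Union>x\<in>a. E k x) \<in> PK" by (intro small_Union_in_PK[OF a_small])
    obtain a' where a': "a' \<in> C" "a \<union> (\<Union>k\<in>a. N k) \<union> (\<Union>k\<in>a. \<Union>x\<in>a. E k x) \<subseteq> a'"
      using C_cof[OF Un_in_PK[OF Un_in_PK[OF a 1] 2]] by blast
    have "\<exists>\<gamma>\<in>fst (cd k). \<iota> \<gamma> \<in> a' - a" if k: "k \<in> a" "\<kappa> \<le>o |fst (cd k)|" for k
    proof -
      have "new k \<in> Field r" using new[OF k] cd1 k(1) aF by blast
      then have "\<iota> (new k) \<in> N k" using iota(2) unfolding N_def by blast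
      then show ?thesis using new[OF k] a'(2) k(1) by blast
    qed
    moreover have "snd (cd k) `` {\<gamma>} \<subseteq> a'"
      if k: "k \<in> a" "\<gamma> \<in> fst (cd k)" "\<iota> \<gamma> \<in> a" "|snd (cd k) `` {\<gamma>}| <o \<kappa>" for k \<gamma>
    proof -
      have "\<gamma> \<in> Field r" using cd1 k(1,2) aF by blast
      then have "inv_into (Field r) \<iota> (\<iota> \<gamma>) = \<gamma>" by (rule inv_into_f_f[OF iota(1)])
      then have "E k (\<iota> \<gamma>) = snd (cd k) `` {\<gamma>}" using k(4) unfolding E_def by simp
      then show ?thesis using a'(2) k(1,3) by blast
    qed
    moreover have "a \<subseteq> a'" using a'(2) by blast
    ultimately show ?thesis using a'(1) unfolding grows_def by blast
  qed
  define A where "A = {c \<in> D. \<exists>a. (\<forall>n. grows (a n) (a (Suc n))) \<and> c = (\<Union>n::nat. a n)}"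
  have A: "A \<in> J_pos"
    unfolding pos_iff
  proof (intro conjI ballI)
    show "A \<subseteq> PK" unfolding A_def using D_sub by blast
    fix x assume x: "x \<in> PK"
    obtain x0 where x0: "x0 \<in> C" "x \<subseteq> x0" using C_cof[OF x] by blast
    obtain nxt where nxt: "\<And>a. a \<in> PK \<Longrightarrow> nxt a \<in> C" "\<And>a. a \<in> PK \<Longrightarrow> grows a (nxt a)" using step by metis
    define a where "a = (\<lambda>n::nat. (nxt ^^ n) x0)"
    have aS: "a (Suc n) = nxt (a n)" for n unfolding a_def by simp
    have aC: "a n \<in> C" for n
    proof (induction n)
      case 0
      show ?case unfolding a_def using x0(1) by simp
    next
      case (Suc n)
      show ?case unfolding aS using nxt(1) Suc C_sub by blast
    qed
    have gr: "grows (a n) (a (Suc n))" for n unfolding aS using nxt(2) aC C_sub by blast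
    have "a n \<subseteq> a (Suc n)" for n using gr unfolding grows_def by blast
    then have mono: "a m \<subseteq> a n" if "m \<le> n" for m n using lift_Suc_mono_le[of a m n] that by blast
    have "chain\<^sub>\<subseteq> (range a)" unfolding chain_subset_def using mono nat_le_linear by blast
    moreover have "|range a| <o \<kappa>" by (rule ordLeq_ordLess_trans[OF card_of_image nat_small])
    moreover have "range a \<subseteq> C" "range a \<noteq> {}" using aC by blast+
    ultimately have "\<Union>(range a) \<in> C" using C_club(1) unfolding club_def by metis
    then have "\<Union>(range a) \<in> A" unfolding A_def using gr C_club(2) by blast
    moreover have "x \<subseteq> \<Union>(range a)"
    proof -
      have "x \<subseteq> a 0" using x0(2) unfolding a_def by simp
      then show ?thesis by blast
    qed
    ultimately show "\<exists>b\<in>A \<inter> D. x \<subseteq> b" unfolding A_def by blast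
  qed
  have "\<forall>c\<in>A. \<exists>a. (\<forall>n. grows (a n) (a (Suc n))) \<and> c = (\<Union>n::nat. a n)" unfolding A_def by blast
  then obtain st :: "'l set \<Rightarrow> nat \<Rightarrow> 'l set" where st: "\<And>c n. c \<in> A \<Longrightarrow> grows (st c n) (st c (Suc n))"
    "\<And>c. c \<in> A \<Longrightarrow> c = (\<Union>n. st c n)"
    by metis
  have st_mono: "st c m \<subseteq> st c n" if "c \<in> A" "m \<le> n" for c m n
    using lift_Suc_mono_le[of "st c" m n] st(1)[OF that(1)] that(2) unfolding grows_def by blast
  obtain \<phi> where phi: "\<And>a. a \<in> PK \<Longrightarrow> \<phi> a \<in> Field r"
    "\<And>\<gamma>. \<gamma> \<in> Field r \<Longrightarrow> {b \<in> PK. \<gamma> \<notin> underS r (\<phi> b)} \<in> J"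
    by (rule ex_rank_function[OF rC rreg kr rL]) blast
  define G where "G = (\<lambda>\<gamma> c. LEAST n. \<iota> \<gamma> \<in> st c n)"
  obtain B n where B: "B \<in> J_pos" "B \<subseteq> A" and Gam: "\<phi> ` B \<subseteq> Field r" "|\<phi> ` B| =o r"
    and bound: "\<And>\<gamma>. \<gamma> \<in> \<phi> ` B \<Longrightarrow> {b \<in> B. n < G \<gamma> b} \<in> J"
    by (rule level_bounding_regular[OF lb A rreg rL phi, of G]) blast+
  have "\<exists>e\<in>PK. \<iota> \<gamma> \<in> e \<and> (\<forall>b\<in>B. e \<subseteq> b \<longrightarrow> G \<gamma> b \<le> n)" if g: "\<gamma> \<in> \<phi> ` B" for \<gamma>
  proof -
    obtain e where e: "e \<in> PK" "\<forall>b\<in>{b \<in> B. n < G \<gamma> b} \<inter> D. \<not> e \<subseteq> b"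
      using bound[OF g] unfolding in_J_iff by blast
    have "\<iota> \<gamma> \<in> Field \<Lambda>" using iota(2) Gam(1) g by blast
    then have "{\<iota> \<gamma>} \<in> PK" by (intro finite_in_PK) simp_all
    then have 1: "insert (\<iota> \<gamma>) e \<in> PK" using Un_in_PK[OF _ e(1), of "{\<iota> \<gamma>}"] by simp
    have "A \<subseteq> D" unfolding A_def by (rule Collect_restrict)
    then have "B \<subseteq> D" using B(2) by (rule subset_trans[rotated])
    have "G \<gamma> b \<le> n" if b: "b \<in> B" "insert (\<iota> \<gamma>) e \<subseteq> b" for b
    proof (rule ccontr)
      assume "\<not> G \<gamma> b \<le> n"
      then have "b \<in> {b \<in> B. n < G \<gamma> b} \<inter> D" using b(1) \<open>B \<subseteq> D\<close> by auto
      then show False using e(2) b(2) by blast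
    qed
    then have "\<forall>b\<in>B. insert (\<iota> \<gamma>) e \<subseteq> b \<longrightarrow> G \<gamma> b \<le> n" by blast
    then show ?thesis by (intro bexI[OF _ 1] conjI) simp_all
  qed
  then obtain e where e: "\<And>\<gamma>. \<gamma> \<in> \<phi> ` B \<Longrightarrow> e \<gamma> \<in> PK" "\<And>\<gamma>. \<gamma> \<in> \<phi> ` B \<Longrightarrow> \<iota> \<gamma> \<in> e \<gamma>"
    "\<And>\<gamma> b. \<gamma> \<in> \<phi> ` B \<Longrightarrow> b \<in> B \<Longrightarrow> e \<gamma> \<subseteq> b \<Longrightarrow> G \<gamma> b \<le> n"
    by metis
  have "cardSuc \<kappa> \<le>o |\<phi> ` B|"
    using ordIso_imp_ordLeq[OF ordIso_symmetric[OF Gam(2)]] unfolding r_def .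
  then obtain X Z where X: "X \<subseteq> \<phi> ` B" "|X| =o \<kappa>" and Z: "Z \<subseteq> Field \<Lambda>" "|Z| <o \<kappa>" "Z \<noteq> {}"
    and eZ: "\<And>\<gamma>. \<gamma> \<in> X \<Longrightarrow> e \<gamma> \<subseteq> (\<Union>z\<in>Z. under \<Lambda> z)"
    by (rule many_sets_in_few_segments[of "\<phi> ` B" e, OF _ e(1)]) blast+
  \<comment> \<open>The part of \<open>e\<close> below \<open>z\<close>; all these relations are coded with the same \<open>X\<close>.\<close>
  define R where "R = (\<lambda>z. {(\<gamma>, s). \<gamma> \<in> X \<and> s \<in> e \<gamma> \<and> s \<in> under \<Lambda> z})"
  have XF: "X \<subseteq> Field r" using X(1) Gam(1) by blast
  have Xle: "|X| \<le>o \<kappa>" by (rule ordIso_imp_ordLeq[OF X(2)])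
  have "\<exists>k\<in>Field \<Lambda>. cd k = (X, R z)" if z: "z \<in> Z" for z
  proof (rule cd3[OF XF Xle])
    show "z \<in> Field \<Lambda>" using Z(1) z by blast
    show "R z \<subseteq> X \<times> under \<Lambda> z" unfolding R_def by blast
    have "|e \<gamma>| \<le>o \<kappa>" if "\<gamma> \<in> X" for \<gamma>
    proof -
      have "e \<gamma> \<in> PK" using e(1) X(1) that by blast
      then show ?thesis using ordLess_imp_ordLeq[of "|e \<gamma>|" \<kappa>] unfolding Pkl_def by simp
    qed
    then have "|Sigma X e| \<le>o \<kappa>"
      using card_of_Sigma_ordLeq_infinite_Field[of \<kappa> X e] kappa_inf Xle unfolding cinfinite_def by blast
    moreover have "R z \<subseteq> Sigma X e" unfolding R_def by blast
    ultimately show "|R z| \<le>o \<kappa>" using ordLeq_transitive[OF card_of_mono1[of "R z"]] by blast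
  qed
  then obtain kz where kz: "\<And>z. z \<in> Z \<Longrightarrow> kz z \<in> Field \<Lambda>" "\<And>z. z \<in> Z \<Longrightarrow> cd (kz z) = (X, R z)" by metis
  have "kz ` Z \<in> PK"
    using ordLeq_ordLess_trans[OF card_of_image[of kz] Z(2)] kz(1) unfolding Pkl_def by auto
  then obtain b where b: "b \<in> B" "kz ` Z \<subseteq> b" using B(1) unfolding pos_iff by blast
  have bA: "b \<in> A" using b(1) B(2) by blast
  obtain z0 where z0: "z0 \<in> Z" using Z(3) by blast
  have "kz z0 \<in> b" using b(2) z0 by blast
  then obtain m0 where m0: "kz z0 \<in> st b m0" using st(2)[OF bA] by blast
  \<comment> \<open>An element of \<open>X\<close> that is new after stage \<open>m\<close> enters after stage \<open>n\<close>.\<close>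
  define m where "m = max m0 n"
  have "kz z0 \<in> st b m" using m0 st_mono[OF bA, of m0 m] unfolding m_def by auto
  moreover have "\<kappa> \<le>o |fst (cd (kz z0))|"
    using ordIso_imp_ordLeq[OF ordIso_symmetric[OF X(2)]] kz(2)[OF z0] by simp
  ultimately obtain \<gamma> where g: "\<gamma> \<in> fst (cd (kz z0))" "\<iota> \<gamma> \<in> st b (Suc m) - st b m"
    using st(1)[OF bA, of m] unfolding grows_def by blast
  have gX: "\<gamma> \<in> X" using g(1) kz(2)[OF z0] by simp
  have "R z `` {\<gamma>} \<subseteq> b" if z: "z \<in> Z" for z
  proof -
    have "kz z \<in> b" using b(2) z by blast
    then obtain p where p: "kz z \<in> st b p" using st(2)[OF bA] by blast
    define q where "q = max p (Suc m)"
    have "kz z \<in> st b q" using p st_mono[OF bA, of p q] unfolding q_def by auto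
    moreover have "\<iota> \<gamma> \<in> st b q" using g(2) st_mono[OF bA, of "Suc m" q] unfolding q_def by auto
    moreover have "\<gamma> \<in> fst (cd (kz z))" "snd (cd (kz z)) = R z" using gX kz(2)[OF z] by simp_all
    moreover have "|R z `` {\<gamma>}| <o \<kappa>"
    proof (rule ordLeq_ordLess_trans[OF card_of_mono1])
      show "R z `` {\<gamma>} \<subseteq> e \<gamma>" unfolding R_def by blast
      have "e \<gamma> \<in> PK" using e(1) gX X(1) by blast
      then show "|e \<gamma>| <o \<kappa>" unfolding Pkl_def by simp
    qed
    ultimately have "R z `` {\<gamma>} \<subseteq> st b (Suc q)"
      using st(1)[OF bA, of q] unfolding grows_def by metis
    then show ?thesis using st(2)[OF bA] by blast
  qed
  moreover have "e \<gamma> \<subseteq> (\<Union>z\<in>Z. R z `` {\<gamma>})" using eZ[OF gX] gX unfolding R_def by blast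
  ultimately have "e \<gamma> \<subseteq> b" by blast
  then have "G \<gamma> b \<le> n" using e(3) gX X(1) b(1) by blast
  then have "G \<gamma> b \<le> m" unfolding m_def by simp
  moreover have "\<iota> \<gamma> \<in> st b (G \<gamma> b)" unfolding G_def by (rule LeastI) (use g(2) in blast)
  ultimately have "\<iota> \<gamma> \<in> st b m" using st_mono[OF bA] by blast
  then show False using g(2) by blast
qed

end

section \<open>Failure of the partition and distributivity properties\<close>

theorem theorem1p2:
  fixes \<kappa> :: "'k rel" and \<Lambda> :: "'l rel" and D :: "'l set set" and J :: "'l set set set"
  assumes "Card_order \<kappa>" and "natLeq <o \<kappa>" and "regularCard \<kappa>"
    and "Card_order \<Lambda>" and "\<kappa> \<le>o \<Lambda>"
    and "ctwo ^c \<kappa> \<le>o \<Lambda>"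
    and "D \<in> ideal_dual (Pkl \<kappa> \<Lambda>) (NS_ideal \<kappa> \<Lambda>)"
    and "J = ideal_restrict (Pkl \<kappa> \<Lambda>) (I_ideal \<kappa> \<Lambda>) D"
  shows "\<not> partition_rel (Pkl \<kappa> \<Lambda>) (ideal_pos (Pkl \<kappa> \<Lambda>) J) J J 2 natLeq \<and>
         \<not> partition_rel (Pkl \<kappa> \<Lambda>) (ideal_pos (Pkl \<kappa> \<Lambda>) J) J J 3 ctwo \<and>
         \<not> distributive (Pkl \<kappa> \<Lambda>) J \<Lambda> ctwo"
proof -
  have D: "D \<subseteq> Pkl \<kappa> \<Lambda>" "Pkl \<kappa> \<Lambda> - D \<in> NS_ideal \<kappa> \<Lambda>"
    using assms(7) unfolding ideal_dual_def by blast+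
  then obtain C where C: "club \<kappa> \<Lambda> C" "(Pkl \<kappa> \<Lambda> - D) \<inter> C = {}"
    unfolding NS_ideal_def by blast
  have "C \<subseteq> Pkl \<kappa> \<Lambda>" using C(1) unfolding club_def by metis
  then have CD: "C \<subseteq> D" using C(2) by blast
  interpret club_ideal \<kappa> \<Lambda> C D J
    by unfold_locales (fact assms C(1) CD D(1))+
  show ?thesis
    using not_level_bounding level_bounding_if_pairs level_bounding_if_triples
      level_bounding_if_distributive by blast
qed

end
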